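(* Let $p$ be a prime, $q=p^{2h}$ with $h\ge 2$, let $R\ge 2$ be even, let $t\ge 1$ be an integer and $r=tR+\frac{R}{2}$. Then there exists an $[n,n-r]_qR$ code (covering radius $R$) with \[ n=R\Big(1+\frac{\sqrt{q}-1}{\sqrt{q}\,(\phi(\sqrt{q}\,)-1)}\Big)q^{(r-R)/R}+R\left\lfloor q^{(r-2R)/R-0.5}\right\rfloor+\frac{R}{2}f_q(r,R)\quad\text{if } p\ge 3, \] and there exists an $[n,n-r]_qR$ code with \[ n=R\Big(1+\frac{1}{p}+\frac{1}{\sqrt{q}}\Big)q^{(r-R)/R}+R\left\lfloor q^{(r-2R)/R-0.5}\right\rfloor+\frac{R}{2}f_q(r,R)\quad\text{if } p\ge 7. \]
   Context: $\phi(Q)$ denotes the order of the largest proper subfield of $\mathbb{F}_Q$. For integers $r,R$: $f_q(r,R)=0$ if $r\notin\{\frac{9R}{2},\frac{13R}{2}\}$, and $f_q(r,R)=q^{(r-3R)/R-0.5}+q^{(r-4R)/R-0.5}$ if $r\in\{\frac{9R}{2},\frac{13R}{2}\}$. An $[n,n-r]_qR$ code is a $q$-ary linear code of length $n$, codimension $r$ and covering radius $R$, where the covering radius is the least $R$ such that every column of $\mathbb{F}_q^r$ is a linear combination of at most $R$ columns of a parity check matrix. *)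

theory Defs
  imports Complex_Main "HOL-Library.Cardinality" "HOL-Computational_Algebra.Primes" "HOL-Algebra.Subrings"
    "Jordan_Normal_Form.VS_Connect" "Jordan_Normal_Form.Matrix_Kernel"
begin

(* The order of the largest proper subfield of the field with Q elements. All fields with Q
   elements are isomorphic, so K may range over the proper subfields of every such field; each
   isomorphism class has representatives with carrier a set of naturals. If Q is not a prime
   power, or is prime, the set is empty and the value is unspecified. *)
definition phi :: "nat \<Rightarrow> nat" where
  "phi Q = Max {card K | K (F :: nat ring).
     field F \<and> card (carrier F) = Q \<and> subfield K F \<and> K \<noteq> carrier F}"

definition f_corr :: "nat \<Rightarrow> int \<Rightarrow> int \<Rightarrow> real" where
  "f_corr q r R =
     (if real_of_int r \<in> {9 * real_of_int R / 2, 13 * real_of_int R / 2}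
      then real q powr ((real_of_int r - 3 * real_of_int R) / real_of_int R - 1 / 2)
         + real q powr ((real_of_int r - 4 * real_of_int R) / real_of_int R - 1 / 2)
      else 0)"

(* The q-ary alphabet is the finite field type 'a, with q = CARD('a). *)
definition linear_code :: "nat \<Rightarrow> nat \<Rightarrow> 'a::{field,finite} vec set \<Rightarrow> bool" where
  "linear_code n r C \<longleftrightarrow>
     VectorSpace.subspace class_ring C (module_vec TYPE('a) n) \<and>
     vectorspace.dim class_ring ((module_vec TYPE('a) n)\<lparr>carrier := C\<rparr>) + r = n"

(* For a linear code of codimension r, a matrix with r rows and kernel C has rank r. *)
definition parity_check_matrix ::
    "nat \<Rightarrow> nat \<Rightarrow> 'a::{field,finite} mat \<Rightarrow> 'a vec set \<Rightarrow> bool" where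
  "parity_check_matrix n r H C \<longleftrightarrow> H \<in> carrier_mat r n \<and> C = mat_kernel H"

(* H *v x is the linear combination of the columns of H with coefficients x; the columns that
   take part are those with x $ i nonzero. *)
definition columns_cover :: "'a::{field,finite} mat \<Rightarrow> nat \<Rightarrow> bool" where
  "columns_cover H \<rho> \<longleftrightarrow>
     (\<forall>v \<in> carrier_vec (dim_row H). \<exists>x \<in> carrier_vec (dim_col H).
        card {i. i < dim_col H \<and> x $ i \<noteq> 0} \<le> \<rho> \<and> H *\<^sub>v x = v)"

definition has_covering_radius :: "'a::{field,finite} mat \<Rightarrow> nat \<Rightarrow> bool" where
  "has_covering_radius H R \<longleftrightarrow>
     columns_cover H R \<and> (\<forall>\<rho> < R. \<not> columns_cover H \<rho>)"

(* C is an [n, n-r]_q R code. The covering radius does not depend on the choice of the parity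
   check matrix: two of them differ by an invertible factor on the left. *)
definition covering_code ::
    "nat \<Rightarrow> nat \<Rightarrow> nat \<Rightarrow> 'a::{field,finite} vec set \<Rightarrow> bool" where
  "covering_code n r R C \<longleftrightarrow>
     linear_code n r C \<and> (\<exists>H. parity_check_matrix n r H C \<and> has_covering_radius H R)"

end

theory Submission
  imports Defs "HOL-Algebra.Weak_Morphisms" "HOL-Algebra.Multiplicative_Group"
begin

text \<open>Only codes of radius 2 and codimension \<open>2 * t + 1\<close> are needed: \<open>R div 2\<close> copies of such a code are
  added directly, and zero columns pad the length to the exact value.

  Let \<open>k\<close> be a proper subfield of the field \<open>K\<close> of order \<open>s = p ^ h\<close>. A \<open>k\<close>-subspace of \<open>K\<^sup>3\<close> with more than \<open>s\<close>
  vectors meets every \<open>K\<close>-plane, so it gives a blocking set of \<open>PG(2,s)\<close>; two subspaces of trace type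
  are placed so that their blocking sets, of \<open>s + s / card k + 1\<close> points each, are disjoint. Every
  vector of \<open>F\<^sup>3\<close>, \<open>F\<close> the field of order \<open>q = s\<^sup>2\<close>, lies on a \<open>K\<close>-plane, which contains two of these
  points; this is the case \<open>t = 1\<close>. The first length uses \<open>card k = phi s\<close>, the second \<open>card k = p\<close>.

  One passes from \<open>t\<close> to \<open>t + 1\<close> by replacing a column \<open>g\<close> with the columns \<open>(g, \<xi>, \<beta> \<xi>)\<close>, \<open>\<xi>\<close> in \<open>F\<close>, where
  the slope \<open>\<beta>\<close> depends on \<open>g\<close>. A vector with nonzero old part is a combination of two old columns of
  different slopes, and the new coordinates are then solved for. A vector \<open>(0, x, y)\<close> is a multiple of the
  difference of two new columns over the same \<open>g\<close>, if \<open>g\<close> has the right slope; for this all \<open>q + 1\<close> slopes have to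
  occur, and these two columns need different slopes at the next level. Keeping a stock of columns not
  yet used in such differences makes this possible at every level, so that the terms \<open>f_corr\<close> are only
  padding.\<close>

section \<open>Functionals over a subfield\<close>

text \<open>The fields \<open>k\<close>, \<open>K\<close> and \<open>F\<close> all live in one type,
  so subfields are subsets closed under its operations. Since \<open>inverse 0 = 0\<close>, closure
  under inverses can be stated for every element.\<close>

locale subfield_set =
  fixes k :: "'a::field set"
  assumes one_mem: "1 \<in> k"
    and diff_mem: "x \<in> k \<Longrightarrow> y \<in> k \<Longrightarrow> x - y \<in> k"
    and mult_mem: "x \<in> k \<Longrightarrow> y \<in> k \<Longrightarrow> x * y \<in> k"
    and inverse_mem: "x \<in> k \<Longrightarrow> inverse x \<in> k"
begin

lemma zero_mem: "0 \<in> k"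
  using diff_mem[OF one_mem one_mem] by simp

lemma uminus_mem: "x \<in> k \<Longrightarrow> - x \<in> k"
  using diff_mem[OF zero_mem] by fastforce

lemma add_mem: "x \<in> k \<Longrightarrow> y \<in> k \<Longrightarrow> x + y \<in> k"
  using diff_mem[of x "- y"] uminus_mem[of y] by simp

lemma divide_mem: "x \<in> k \<Longrightarrow> y \<in> k \<Longrightarrow> x / y \<in> k"
  unfolding divide_inverse by (intro mult_mem inverse_mem)

lemmas closed = zero_mem one_mem add_mem diff_mem uminus_mem mult_mem inverse_mem divide_mem

end

locale subfield_pair = k: subfield_set k + K: subfield_set K
  for k K :: "'a::{field,finite} set" +
  assumes sub: "k \<subseteq> K"
begin

definition functional :: "('a \<Rightarrow> 'a) \<Rightarrow> bool" where
  "functional T \<longleftrightarrow> (\<forall>x\<in>K. T x \<in> k) \<and> (\<forall>x\<in>K. \<forall>y\<in>K. T (x + y) = T x + T y) \<and>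
     (\<forall>c\<in>k. \<forall>x\<in>K. T (c * x) = c * T x)"

lemma functional_mem: "functional T \<Longrightarrow> x \<in> K \<Longrightarrow> T x \<in> k"
  and functional_add: "functional T \<Longrightarrow> x \<in> K \<Longrightarrow> y \<in> K \<Longrightarrow> T (x + y) = T x + T y"
  and functional_scale: "functional T \<Longrightarrow> c \<in> k \<Longrightarrow> x \<in> K \<Longrightarrow> T (c * x) = c * T x"
  unfolding functional_def by blast+

lemma functional_zero: "functional T \<Longrightarrow> T 0 = 0"
  using functional_scale[OF _ k.zero_mem K.zero_mem] by simp

lemma functional_diff: "functional T \<Longrightarrow> x \<in> K \<Longrightarrow> y \<in> K \<Longrightarrow> T (x - y) = T x - T y"
  using functional_add[of T "x - y" y] K.diff_mem[of x y] by (simp add: algebra_simps)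

(* A k-subspace that is maximal among those containing u but not v is a hyperplane. *)
lemma exists_functional:
  assumes u: "u \<in> K" and v: "v \<in> K" and uv: "\<And>c. c \<in> k \<Longrightarrow> v \<noteq> c * u"
  shows "\<exists>T. functional T \<and> T u = 0 \<and> T v = 1"
proof -
  let ?P = "\<lambda>H. H \<subseteq> K \<and> 0 \<in> H \<and> (\<forall>x\<in>H. \<forall>y\<in>H. x + y \<in> H) \<and> (\<forall>c\<in>k. \<forall>x\<in>H. c * x \<in> H) \<and> u \<in> H \<and> v \<notin> H"
  have "?P ((\<lambda>c. c * u) ` k)"
  proof (intro conjI ballI)
    show "(\<lambda>c. c * u) ` k \<subseteq> K" using u sub K.mult_mem by auto
    show "0 \<in> (\<lambda>c. c * u) ` k" using k.zero_mem by force
    show "u \<in> (\<lambda>c. c * u) ` k" using k.one_mem by force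
    show "v \<notin> (\<lambda>c. c * u) ` k" using uv by auto
  next
    fix x y assume "x \<in> (\<lambda>c. c * u) ` k" "y \<in> (\<lambda>c. c * u) ` k"
    then obtain c d where "c \<in> k" "d \<in> k" "x = c * u" "y = d * u" by auto
    then show "x + y \<in> (\<lambda>c. c * u) ` k"
      using k.add_mem[of c d] by (intro image_eqI[of _ _ "c + d"]) (auto simp: algebra_simps)
  next
    fix c x assume "c \<in> k" "x \<in> (\<lambda>c. c * u) ` k"
    then obtain d where "d \<in> k" "x = d * u" by auto
    then show "c * x \<in> (\<lambda>c. c * u) ` k" using \<open>c \<in> k\<close> k.mult_mem[of c d]
      by (intro image_eqI[of _ _ "c * d"]) auto
  qed
  then have "{H. ?P H} \<noteq> {}" by blast
  then obtain H where H: "?P H" and max: "\<And>H'. ?P H' \<Longrightarrow> H \<subseteq> H' \<Longrightarrow> H = H'"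
    using finite_has_maximal[of "{H. ?P H}"] by auto
  have Hadd: "\<And>x y. x \<in> H \<Longrightarrow> y \<in> H \<Longrightarrow> x + y \<in> H" and Hsc: "\<And>c x. c \<in> k \<Longrightarrow> x \<in> H \<Longrightarrow> c * x \<in> H"
    and HK: "H \<subseteq> K" and H0: "0 \<in> H" and uH: "u \<in> H" and vH: "v \<notin> H"
    using H by auto
  have Hneg: "\<And>x. x \<in> H \<Longrightarrow> - x \<in> H" using Hsc[of "-1"] k.one_mem k.uminus_mem by fastforce
  have Hdiff: "\<And>x y. x \<in> H \<Longrightarrow> y \<in> H \<Longrightarrow> x - y \<in> H" using Hadd Hneg by (metis diff_conv_add_uminus)
  \<comment> \<open>If \<open>x\<close> were not congruent modulo \<open>H\<close> to a
    \<open>k\<close>-multiple of \<open>v\<close>, then \<open>H + k * x\<close> would be a larger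
    subspace still missing \<open>v\<close>.\<close>
  have ex: "\<exists>c\<in>k. x - c * v \<in> H" if x: "x \<in> K" for x
  proof (rule ccontr)
    assume no: "\<not> ?thesis"
    define H' where "H' = (\<lambda>(h, c). h + c * x) ` (H \<times> k)"
    have mem: "h + c * x \<in> H'" if "h \<in> H" "c \<in> k" for h c
      unfolding H'_def using that by force
    have sub': "H \<subseteq> H'"
      using mem[OF _ k.zero_mem] by auto
    have "v \<notin> H'"
    proof
      assume "v \<in> H'"
      then obtain h c where hc: "h \<in> H" "c \<in> k" "v = h + c * x" unfolding H'_def by auto
      with vH have c0: "c \<noteq> 0" by auto
      have "x - inverse c * v = - (inverse c * h)" using hc c0 by (simp add: field_simps)
      then show False using no hc Hneg Hsc k.inverse_mem by metis
    qed
    moreover have "H' \<subseteq> K" using HK x sub unfolding H'_def by (auto intro!: K.add_mem K.mult_mem)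
    moreover have "\<forall>a\<in>H'. \<forall>b\<in>H'. a + b \<in> H'"
    proof (intro ballI)
      fix a b assume "a \<in> H'" "b \<in> H'"
      then obtain h c h' c' where "h \<in> H" "c \<in> k" "a = h + c * x" "h' \<in> H" "c' \<in> k" "b = h' + c' * x"
        unfolding H'_def by auto
      then show "a + b \<in> H'" using mem[of "h + h'" "c + c'"] Hadd k.add_mem
        by (simp add: algebra_simps)
    qed
    moreover have "\<forall>d\<in>k. \<forall>a\<in>H'. d * a \<in> H'"
    proof (intro ballI)
      fix d a assume "d \<in> k" "a \<in> H'"
      then obtain h c where "h \<in> H" "c \<in> k" "a = h + c * x"
        unfolding H'_def by auto
      then show "d * a \<in> H'" using mem[of "d * h" "d * c"] Hsc k.mult_mem \<open>d \<in> k\<close>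
        by (simp add: algebra_simps)
    qed
    ultimately have "?P H'" using sub' H0 uH by (intro conjI) (assumption | blast)+
    then have "H = H'" using sub' by (rule max)
    then have "x \<in> H" using mem[OF H0 k.one_mem] by simp
    then show False using no k.zero_mem by force
  qed
  have uniq: "c = c'" if "c \<in> k" "c' \<in> k" "x - c * v \<in> H" "x - c' * v \<in> H" for c c' x
  proof (rule ccontr)
    assume ne: "c \<noteq> c'"
    have "(c' - c) * v \<in> H" using Hdiff[OF that(3,4)] by (simp add: algebra_simps)
    then have "inverse (c' - c) * ((c' - c) * v) \<in> H" by (rule Hsc[rotated]) (intro k.inverse_mem k.diff_mem that)
    moreover have "inverse (c' - c) * ((c' - c) * v) = v" using ne by simp
    ultimately show False using vH by simp
  qed
  \<comment> \<open>\<open>T x\<close> is the coordinate of \<open>x\<close> along \<open>v\<close>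
    in the decomposition of \<open>K\<close> into \<open>H\<close> and \<open>k * v\<close>;
    \<open>ex\<close> and \<open>uniq\<close> make it well defined.\<close>
  define T where "T = (\<lambda>x. THE c. c \<in> k \<and> x - c * v \<in> H)"
  have T_eq: "T x = c" if "c \<in> k" "x - c * v \<in> H" for x c
    unfolding T_def using that uniq by blast
  have T: "T x \<in> k" "x - T x * v \<in> H" if "x \<in> K" for x
    using ex[OF that] T_eq by blast+
  have "functional T" unfolding functional_def
  proof (intro conjI ballI)
    fix x y assume "x \<in> K" "y \<in> K"
    then show "T (x + y) = T x + T y"
      using T[of x] T[of y] Hadd[of "x - T x * v" "y - T y * v"] k.add_mem
      by (intro T_eq) (auto simp: algebra_simps)
  next
    fix c x assume "c \<in> k" "x \<in> K"
    then show "T (c * x) = c * T x"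
      using T[of x] Hsc[of c "x - T x * v"] k.mult_mem
      by (intro T_eq) (auto simp: algebra_simps)
  qed (use T in auto)
  moreover have "T u = 0" using uH k.zero_mem by (intro T_eq) auto
  moreover have "T v = 1" using H0 k.one_mem by (intro T_eq) auto
  ultimately show ?thesis by blast
qed

definition fibre :: "('a \<Rightarrow> 'a) \<Rightarrow> 'a \<Rightarrow> 'a set" where
  "fibre T c = {x \<in> K. T x = c}"

lemma card_fibre:
  assumes T: "functional T" and w: "w \<in> K" "T w = 1" and c: "c \<in> k"
  shows "card (fibre T c) = card (fibre T 0)"
proof -
  have "bij_betw (\<lambda>x. x + c * w) (fibre T 0) (fibre T c)"
    by (rule bij_betw_byWitness[where f' = "\<lambda>x. x - c * w"])
      (use c w sub in \<open>auto simp: fibre_def functional_add[OF T] functional_diff[OF T] functional_scale[OF T]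
        K.add_mem K.diff_mem K.mult_mem subset_iff\<close>)
  then show ?thesis using bij_betw_same_card by fastforce
qed

text \<open>\<open>K\<close> is the direct sum of the kernel of \<open>T\<close> and the line
  \<open>k * w\<close>.\<close>

lemma card_kernel:
  assumes T: "functional T" and w: "w \<in> K" "T w = 1"
  shows "card (fibre T 0) * card k = card K"
proof -
  have "bij_betw (\<lambda>(x, c). x + c * w) (fibre T 0 \<times> k) K"
    by (rule bij_betw_byWitness[where f' = "\<lambda>x. (x - T x * w, T x)"])
      (use w sub in \<open>auto simp: fibre_def functional_add[OF T] functional_diff[OF T] functional_scale[OF T]
        functional_mem[OF T] K.add_mem K.diff_mem K.mult_mem subset_iff\<close>)
  then show ?thesis using bij_betw_same_card card_cartesian_product by metis
qed

end

(* The pairs (u, v) with u * n + v = D n form a line; the card k - 1 lines meet the nonzero pairs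
   in at most card k - 1 points each, and the line for n = 1 in fewer. *)
lemma (in subfield_set) avoid_lines:
  assumes fin: "finite k" and D: "\<And>n. n \<in> k \<Longrightarrow> D n \<in> k" and D1: "D 1 \<noteq> 0"
  shows "\<exists>u\<in>k - {0}. \<exists>v\<in>k - {0}. \<forall>n\<in>k - {0}. u * n + v \<noteq> D n"
proof (rule ccontr)
  assume no: "\<not> ?thesis"
  let ?S = "k - {0}"
  define L where "L = (\<lambda>n. {(u, v). u \<in> ?S \<and> v \<in> ?S \<and> u * n + v = D n})"
  have img: "L n \<subseteq> (\<lambda>u. (u, D n - u * n)) ` ?S" for n unfolding L_def by (auto simp: image_iff algebra_simps)
  have finL: "finite (L n)" for n using finite_subset[OF img] fin by simp
  have cL: "card (L n) \<le> card ?S" for n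
    using fin img by (intro surj_card_le) auto
  have "L 1 \<subseteq> (\<lambda>u. (u, D 1 - u)) ` (?S - {D 1})" unfolding L_def by (auto simp: image_iff algebra_simps)
  then have "card (L 1) \<le> card (?S - {D 1})"
    using fin by (intro surj_card_le) auto
  also have "\<dots> < card ?S"
    using D[OF one_mem] D1 fin by (intro psubset_card_mono) auto
  finally have c1: "card (L 1) < card ?S" .
  have "?S \<times> ?S \<subseteq> (\<Union>n\<in>?S. L n)" using no unfolding L_def by fastforce
  then have "card ?S * card ?S \<le> card (\<Union>n\<in>?S. L n)"
    using fin finL by (metis card_cartesian_product card_mono finite_Diff finite_UN_I)
  also have "\<dots> \<le> (\<Sum>n\<in>?S. card (L n))" using fin by (intro card_UN_le) auto
  also have "\<dots> < (\<Sum>n\<in>?S. card ?S)"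
    using fin one_mem c1 cL by (intro sum_strict_mono_ex1) auto
  finally show False by simp
qed

section \<open>Two disjoint blocking sets\<close>

context subfield_pair
begin

text \<open>Projective points of the \<open>k\<close>-subspace of all \<open>(x, l, m)\<close> with
  \<open>x\<close> in \<open>K\<close>, \<open>l\<close> and \<open>m\<close> in \<open>k\<close>
  and \<open>T x = V * l\<close>, scaled so that \<open>l = 1\<close>, or \<open>l = 0\<close> and
  \<open>m = 1\<close>, or, if both vanish, \<open>x = 1\<close>. In the last case the scaled vector
  \<open>(1, 0, 0)\<close> may itself lie outside the subspace.\<close>

definition block1 :: "('a \<Rightarrow> 'a) \<Rightarrow> 'a \<Rightarrow> ('a \<times> 'a \<times> 'a) set" where
  "block1 T V = insert (1, 0, 0)
     ((\<lambda>(x, m). (x, 1, m)) ` (fibre T V \<times> k) \<union> (\<lambda>x. (x, 0, 1)) ` fibre T 0)"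

text \<open>Projective points of the \<open>k\<close>-subspace of all
  \<open>(m, y, \<theta> * y + l + \<theta> * m)\<close> with \<open>y\<close> in \<open>K\<close>,
  \<open>l\<close> and \<open>m\<close> in \<open>k\<close> and \<open>T y = u * l + v * m\<close>.
  The vertex has \<open>l = m = 0\<close>; the other two pieces have \<open>m = 1\<close> and
  \<open>l = n\<close>, respectively \<open>m = 0\<close> and \<open>l = 1\<close>.\<close>

definition block2 :: "('a \<Rightarrow> 'a) \<Rightarrow> 'a \<Rightarrow> 'a \<Rightarrow> 'a \<Rightarrow> ('a \<times> 'a \<times> 'a) set" where
  "block2 T u v \<theta> = insert (0, 1, \<theta>)
     ((\<lambda>(n, y). (1, y, \<theta> * y + n + \<theta>)) ` (SIGMA n:k. fibre T (u * n + v)) \<union>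
      (\<lambda>y. (0, y, \<theta> * y + 1)) ` fibre T u)"

lemma fibre_shift:
  assumes T: "functional T" and w: "w \<in> K" "T w = 1" and x: "x \<in> fibre T 0" and c: "c \<in> k"
  shows "x + c * w \<in> K" and "T (x + c * w) = c"
proof -
  have "x \<in> K" "T x = 0" "c * w \<in> K" using x w c sub K.mult_mem by (auto simp: fibre_def)
  then show "x + c * w \<in> K" "T (x + c * w) = c"
    using functional_add[OF T] functional_scale[OF T c w(1)] w K.add_mem by simp_all
qed

lemma card_block1:
  assumes T: "functional T" and w: "w \<in> K" "T w = 1" and V: "V \<in> k"
  shows "card (block1 T V) \<le> card K + card (fibre T 0) + 1"
proof -
  have "card ((\<lambda>(x, m). (x, 1::'a, m)) ` (fibre T V \<times> k)) \<le> card K"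
    using card_image_le[of "fibre T V \<times> k" "\<lambda>(x, m). (x, 1::'a, m)"]
      card_fibre[OF T w V] card_kernel[OF T w] by (simp add: card_cartesian_product)
  moreover have "card ((\<lambda>x. (x, 0::'a, 1::'a)) ` fibre T 0) \<le> card (fibre T 0)"
    by (intro card_image_le) simp
  moreover have "card (block1 T V) \<le> Suc (card ((\<lambda>(x, m). (x, 1::'a, m)) ` (fibre T V \<times> k) \<union> (\<lambda>x. (x, 0, 1)) ` fibre T 0))"
    unfolding block1_def by (rule card_insert_le_m1) auto
  moreover have "card ((\<lambda>(x, m). (x, 1::'a, m)) ` (fibre T V \<times> k) \<union> (\<lambda>x. (x, 0, 1)) ` fibre T 0)
    \<le> card ((\<lambda>(x, m). (x, 1::'a, m)) ` (fibre T V \<times> k)) + card ((\<lambda>x. (x, 0::'a, 1::'a)) ` fibre T 0)"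
    by (rule card_Un_le)
  ultimately show ?thesis by linarith
qed

lemma card_block2:
  assumes T: "functional T" and w: "w \<in> K" "T w = 1" and u: "u \<in> k" and v: "v \<in> k"
  shows "card (block2 T u v \<theta>) \<le> card K + card (fibre T 0) + 1"
proof -
  let ?A = "(\<lambda>(n, y). (1::'a, y, \<theta> * y + n + \<theta>)) ` (SIGMA n:k. fibre T (u * n + v))"
  let ?B = "(\<lambda>y. (0::'a, y, \<theta> * y + 1)) ` fibre T u"
  have "card (SIGMA n:k. fibre T (u * n + v)) = (\<Sum>n\<in>k. card (fibre T (u * n + v)))"
    by (simp add: card_SigmaI)
  also have "\<dots> = (\<Sum>n\<in>k. card (fibre T 0))"
    by (intro sum.cong refl card_fibre[OF T w] k.add_mem k.mult_mem u v)
  also have "\<dots> = card K" using card_kernel[OF T w] by (simp add: mult.commute)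
  finally have sig: "card (SIGMA n:k. fibre T (u * n + v)) = card K" .
  have "card ?A \<le> card K"
    unfolding sig[symmetric] by (rule card_image_le) (rule finite)
  moreover have "card ?B \<le> card (fibre T 0)"
    unfolding card_fibre[OF T w u, symmetric] by (rule card_image_le) (rule finite)
  moreover have "card (block2 T u v \<theta>) \<le> Suc (card (?A \<union> ?B))"
    unfolding block2_def by (rule card_insert_le_m1) auto
  moreover have "card (?A \<union> ?B) \<le> card ?A + card ?B"
    by (rule card_Un_le)
  ultimately show ?thesis by linarith
qed

(* Both sets represent the points of k-subspaces of K^3 with more than card K vectors, so a
   K-linear form on K^3 cannot be injective on them. *)
lemma pigeonhole_line:
  assumes T: "functional T" and w: "w \<in> K" "T w = 1"
    and \<phi>: "\<And>x l m. x \<in> K \<Longrightarrow> l \<in> k \<Longrightarrow> m \<in> k \<Longrightarrow> \<phi> x l m \<in> K"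
    and lin: "\<And>x l m x' l' m'. \<phi> (x - x') (l - l') (m - m') = \<phi> x l m - (\<phi> x' l' m' :: 'a)"
  shows "\<exists>x\<in>fibre T 0. \<exists>l\<in>k. \<exists>m\<in>k. (x, l, m) \<noteq> (0, 0, 0) \<and> \<phi> x l m = 0"
proof -
  let ?D = "fibre T 0 \<times> k \<times> k"
  let ?f = "\<lambda>(x, l, m). \<phi> x l m"
  have k2: "card k > 1"
    using card_mono[of k "{0, 1}"] k.zero_mem k.one_mem by simp
  have cD: "card ?D = card K * card k"
    unfolding card_cartesian_product card_kernel[OF T w, symmetric] by (simp only: mult.assoc)
  have "card K > 0" using K.zero_mem by (auto simp: card_gt_0_iff)
  then have "card K < card ?D" unfolding cD using k2 by simp
  moreover have "?f ` ?D \<subseteq> K" using \<phi> by (auto simp: fibre_def)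
  then have "card (?f ` ?D) \<le> card K" by (intro card_mono) auto
  ultimately have "\<not> inj_on ?f ?D" using pigeonhole[of ?f ?D] by linarith
  then obtain x l m x' l' m' where *: "(x, l, m) \<in> ?D" "(x', l', m') \<in> ?D"
    "(x, l, m) \<noteq> (x', l', m')" "\<phi> x l m = \<phi> x' l' m'"
    unfolding inj_on_def by auto
  have "x - x' \<in> fibre T 0" using * by (auto simp: fibre_def functional_diff[OF T] K.diff_mem)
  moreover have "l - l' \<in> k" "m - m' \<in> k" using * k.diff_mem by auto
  moreover have "(x - x', l - l', m - m') \<noteq> (0, 0, 0)" "\<phi> (x - x') (l - l') (m - m') = 0"
    using * lin by auto
  ultimately show ?thesis by blast
qed

lemma block1_meets_line:
  assumes T: "functional T" and w: "w \<in> K" "T w = 1" and V: "V \<in> k"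
    and abc: "a \<in> K" "b \<in> K" "c \<in> K"
  shows "\<exists>x y z. (x, y, z) \<in> block1 T V \<and> a * x + b * y + c * z = 0"
proof -
  \<comment> \<open>The pigeonhole runs over the kernel of \<open>T\<close>; adding
    \<open>V * l * w\<close> moves its elements into the fibre over \<open>V * l\<close>.\<close>
  have "\<exists>x\<in>fibre T 0. \<exists>l\<in>k. \<exists>m\<in>k. (x, l, m) \<noteq> (0, 0, 0) \<and>
      a * (x + V * l * w) + b * l + c * m = 0"
    by (rule pigeonhole_line[OF T w])
      (use V abc w sub in \<open>auto simp: algebra_simps intro!: K.add_mem K.mult_mem\<close>)
  then obtain x0 l m where x0: "x0 \<in> fibre T 0" and lm: "l \<in> k" "m \<in> k" "(x0, l, m) \<noteq> (0, 0, 0)"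
    and eq: "a * (x0 + V * l * w) + b * l + c * m = 0" by blast
  define x where "x = x0 + V * l * w"
  have xK: "x \<in> K" and Tx: "T x = V * l"
    using fibre_shift[OF T w x0 k.mult_mem[OF V lm(1)]] by (simp_all add: x_def)
  have eq': "a * x + b * l + c * m = 0" using eq by (simp add: x_def)
  have sc: "x / d \<in> K" "T (x / d) = T x / d" if "d \<in> k" for d
  proof -
    have "inverse d * x = x / d" by (simp add: field_simps)
    then show "T (x / d) = T x / d"
      using functional_scale[OF T k.inverse_mem[OF that] xK] by (simp add: field_simps)
    show "x / d \<in> K" using xK that sub by (intro K.divide_mem) auto
  qed
  \<comment> \<open>Each case divides the vector by the coordinate that \<open>block1\<close>
    normalises to 1.\<close>
  consider "l \<noteq> 0" | "l = 0" "m \<noteq> 0" | "l = 0" "m = 0" "x \<noteq> 0" using lm by (auto simp: x_def)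
  then show ?thesis
  proof cases
    case 1
    have "x / l \<in> fibre T V" using sc[OF lm(1)] Tx 1 by (simp add: fibre_def)
    then have "(x / l, 1, m / l) \<in> block1 T V" using lm k.divide_mem unfolding block1_def by force
    moreover have "a * (x / l) + b * 1 + c * (m / l) = 0" using eq' 1 by (simp add: field_simps)
    ultimately show ?thesis by blast
  next
    case 2
    have "x / m \<in> fibre T 0" using sc[OF lm(2)] Tx 2 by (simp add: fibre_def)
    then have "(x / m, 0, 1) \<in> block1 T V" unfolding block1_def by force
    moreover have "a * (x / m) + b * 0 + c * 1 = 0" using eq' 2 by (simp add: field_simps)
    ultimately show ?thesis by blast
  next
    case 3
    then show ?thesis using eq' unfolding block1_def by (intro exI[of _ 1] exI[of _ 0]) auto
  qed
qed

lemma block2_meets_line: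
  assumes T: "functional T" and w: "w \<in> K" "T w = 1" and u: "u \<in> k" and v: "v \<in> k"
    and \<theta>: "\<theta> \<in> K" and abc: "a \<in> K" "b \<in> K" "c \<in> K"
  shows "\<exists>x y z. (x, y, z) \<in> block2 T u v \<theta> \<and> a * x + b * y + c * z = 0"
proof -
  have "\<exists>x\<in>fibre T 0. \<exists>l\<in>k. \<exists>m\<in>k. (x, l, m) \<noteq> (0, 0, 0) \<and>
      a * m + b * (x + (u * l + v * m) * w) + c * (\<theta> * (x + (u * l + v * m) * w) + l + \<theta> * m) = 0"
    by (rule pigeonhole_line[OF T w])
      (use u v \<theta> abc w sub in \<open>auto simp: algebra_simps intro!: K.add_mem K.mult_mem\<close>)
  then obtain x0 l m where x0: "x0 \<in> fibre T 0" and lm: "l \<in> k" "m \<in> k" "(x0, l, m) \<noteq> (0, 0, 0)"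
    and eq: "a * m + b * (x0 + (u * l + v * m) * w) + c * (\<theta> * (x0 + (u * l + v * m) * w) + l + \<theta> * m) = 0"
    by blast
  define y where "y = x0 + (u * l + v * m) * w"
  have ul: "u * l + v * m \<in> k" using u v lm k.add_mem k.mult_mem by simp
  have yK: "y \<in> K" and Ty: "T y = u * l + v * m"
    using fibre_shift[OF T w x0 ul] by (simp_all add: y_def)
  have eq': "a * m + b * y + c * (\<theta> * y + l + \<theta> * m) = 0" using eq by (simp add: y_def)
  have sc: "y / d \<in> K" "T (y / d) = T y / d" if "d \<in> k" for d
  proof -
    have "inverse d * y = y / d" by (simp add: field_simps)
    then show "T (y / d) = T y / d"
      using functional_scale[OF T k.inverse_mem[OF that] yK] by (simp add: field_simps)
    show "y / d \<in> K" using yK that sub by (intro K.divide_mem) auto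
  qed
  consider "m \<noteq> 0" | "m = 0" "l \<noteq> 0" | "l = 0" "m = 0" "y \<noteq> 0" using lm by (auto simp: y_def)
  then show ?thesis
  proof cases
    case 1
    have "y / m \<in> fibre T (u * (l / m) + v)"
      using sc[OF lm(2)] Ty 1 by (simp add: fibre_def add_divide_distrib)
    then have "(1, y / m, \<theta> * (y / m) + l / m + \<theta>) \<in> block2 T u v \<theta>"
      using lm k.divide_mem unfolding block2_def
      by (intro insertI2 UnI1 image_eqI[of _ _ "(l / m, y / m)"]) auto
    moreover have "a * 1 + b * (y / m) + c * (\<theta> * (y / m) + l / m + \<theta>)
        = (a * m + b * y + c * (\<theta> * y + l + \<theta> * m)) / m"
      using 1 by (simp add: field_simps)
    then have "a * 1 + b * (y / m) + c * (\<theta> * (y / m) + l / m + \<theta>) = 0" using eq' by simp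
    ultimately show ?thesis by blast
  next
    case 2
    have "y / l \<in> fibre T u" using sc[OF lm(1)] Ty 2 by (simp add: fibre_def)
    then have "(0, y / l, \<theta> * (y / l) + 1) \<in> block2 T u v \<theta>" unfolding block2_def by force
    moreover have "a * 0 + b * (y / l) + c * (\<theta> * (y / l) + 1) = 0"
      using eq' 2 by (simp add: field_simps)
    ultimately show ?thesis by blast
  next
    case 3
    \<comment> \<open>The vector found is \<open>y\<close> times the vertex
      \<open>(0, 1, \<theta>)\<close>.\<close>
    then have "y * (b + c * \<theta>) = 0" using eq' by (simp add: algebra_simps)
    then have "a * 0 + b * 1 + c * \<theta> = 0" using 3 by simp
    then show ?thesis unfolding block2_def by blast
  qed
qed

end

text \<open>As \<open>c\<close> is nonzero, a vector of the plane is determined by its first two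
  coordinates, so this is Cramer's rule with the 2 by 2 determinant \<open>d\<close>, which would
  vanish only for proportional vectors. Other planes are reached by permuting the
  coordinates.\<close>

lemma plane_spanned:
  fixes a :: "'a::field"
  assumes c: "c \<noteq> 0" and "a * x + b * y + c * z = 0" and "a * x1 + b * y1 + c * z1 = 0"
    and "a * x2 + b * y2 + c * z2 = 0" and "(x2, y2, z2) \<noteq> (0, 0, 0)"
    and np: "\<And>t. (x1, y1, z1) \<noteq> (t * x2, t * y2, t * z2)"
  shows "\<exists>\<alpha> \<beta>. x = \<alpha> * x1 + \<beta> * x2 \<and> y = \<alpha> * y1 + \<beta> * y2 \<and> z = \<alpha> * z1 + \<beta> * z2"
proof -
  have z: "z = - (a * x + b * y) / c" "z1 = - (a * x1 + b * y1) / c" "z2 = - (a * x2 + b * y2) / c"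
    using assms(2-4) c by (simp_all add: field_simps eq_neg_iff_add_eq_0)
  define d where "d = x1 * y2 - x2 * y1"
  have d: "d \<noteq> 0"
  proof
    assume "d = 0"
    then have e: "x1 * y2 = x2 * y1" by (simp add: d_def)
    consider "x2 \<noteq> 0" | "x2 = 0" "y2 \<noteq> 0" using z assms(5) by auto
    then show False
    proof cases
      case 1
      then have "x1 = x1 / x2 * x2" "y1 = x1 / x2 * y2" using e by (simp_all add: field_simps)
      moreover from this have "z1 = x1 / x2 * z2" using c 1 e unfolding z by (simp add: field_simps)
      ultimately show False using np by metis
    next
      case 2
      then have "x1 = y1 / y2 * x2" "y1 = y1 / y2 * y2" using e by (simp_all add: field_simps)
      moreover from this have "z1 = y1 / y2 * z2" using c 2 e unfolding z by (simp add: field_simps)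
      ultimately show False using np by metis
    qed
  qed
  define \<alpha> \<beta> where "\<alpha> = (x * y2 - x2 * y) / d" and "\<beta> = (x1 * y - x * y1) / d"
  have x: "x = \<alpha> * x1 + \<beta> * x2" and y: "y = \<alpha> * y1 + \<beta> * y2"
    using d unfolding \<alpha>_def \<beta>_def by (simp_all add: field_simps) (simp_all add: d_def algebra_simps)
  moreover have "z = \<alpha> * z1 + \<beta> * z2"
    using c unfolding z x y by (simp add: field_simps)
  ultimately show ?thesis by blast
qed

section \<open>Disjointness, and representations by two points of the union\<close>

context subfield_pair
begin

lemma nontrivial_kernel:
  assumes T: "functional T" and w: "w \<in> K" "T w = 1" and less: "k \<noteq> K"
  shows "\<exists>x. x \<in> K \<and> T x = 0 \<and> x \<noteq> 0"
proof (rule ccontr)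
  assume "\<not> ?thesis"
  then have "fibre T 0 \<subseteq> {0}" by (auto simp: fibre_def)
  then have "card (fibre T 0) \<le> 1" using card_mono[of "{0}"] by auto
  then have "card K \<le> 1 * card k" unfolding card_kernel[OF T w, symmetric] by (intro mult_le_mono1)
  then show False using less sub card_seteq[of K k] by simp
qed

(* T1 vanishes at 1 / \<theta>, and V and V + T1 1 are nonzero; a common point of the two sets then forces u = 0,
   v = 0 or u * n + v = D n for some nonzero n in k. *)
lemma disjoint_blocking_sets:
  assumes k3: "card k \<ge> 3" and less: "k \<noteq> K"
  shows "\<exists>T1 T2 w1 w2 V u v \<theta>. functional T1 \<and> w1 \<in> K \<and> T1 w1 = 1 \<and> functional T2 \<and> w2 \<in> K \<and> T2 w2 = 1 \<and>
    V \<in> k \<and> u \<in> k \<and> v \<in> k \<and> \<theta> \<in> K \<and>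
    (\<forall>x y z x' y' z' c. (x, y, z) \<in> block1 T1 V \<longrightarrow> (x', y', z') \<in> block2 T2 u v \<theta> \<longrightarrow>
      (x, y, z) \<noteq> (c * x', c * y', c * z'))"
proof -
  obtain \<theta> where \<theta>: "\<theta> \<in> K" "\<theta> \<notin> k" using sub less by blast
  have shift_ne: "n + \<theta> \<noteq> 0" if "n \<in> k" for n
    using \<theta> k.uminus_mem[OF that] by (auto simp: add_eq_0_iff)
  have inv_mem: "1 / (n + \<theta>) \<in> K" if "n \<in> k" for n
    using \<theta> that sub by (intro K.divide_mem K.one_mem K.add_mem) auto
  \<comment> \<open>The two inverses are not proportional over \<open>k\<close>: a factor
    \<open>c\<close> would give \<open>\<theta> = c / (1 - c)\<close>. The value 0 at
    \<open>1 / \<theta>\<close> makes \<open>e 0 = 0\<close>; the value 1 at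
    \<open>1 / (1 + \<theta>)\<close> leads to \<open>D 1 = 1\<close> below.\<close>
  have "\<exists>T. functional T \<and> T (1 / (0 + \<theta>)) = 0 \<and> T (1 / (1 + \<theta>)) = 1"
  proof (rule exists_functional[OF inv_mem inv_mem])
    fix c assume c: "c \<in> k"
    show "1 / (1 + \<theta>) \<noteq> c * (1 / (0 + \<theta>))"
    proof
      assume "1 / (1 + \<theta>) = c * (1 / (0 + \<theta>))"
      then have eq: "\<theta> * (1 - c) = c" using shift_ne[OF k.zero_mem] shift_ne[OF k.one_mem] by (simp add: field_simps)
      then have "c \<noteq> 1" by auto
      then have "\<theta> = c / (1 - c)" using eq by (simp add: field_simps)
      then show False using \<theta> c k.closed by metis
    qed
  qed (use k.closed in auto)
  then obtain T1 where T1: "functional T1" and T1_0: "T1 (1 / (0 + \<theta>)) = 0" and T1_1: "T1 (1 / (1 + \<theta>)) = 1"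
    by blast
  \<comment> \<open>Two values are excluded for \<open>V\<close>; here \<open>card k \<ge> 3\<close>
    enters.\<close>
  have "card (k - {0, - T1 1}) \<ge> card k - card {0, - T1 1}" by (rule diff_card_le_card_Diff) simp
  moreover have "card {0, - T1 1} \<le> 2" by (simp add: card_insert_if)
  ultimately have "k - {0, - T1 1} \<noteq> {}" using k3 by force
  then obtain V where "V \<in> k" "V \<noteq> 0" "V \<noteq> - T1 1" by blast
  then have V: "V \<in> k" "V \<noteq> 0" "V + T1 1 \<noteq> 0" by (simp_all add: eq_neg_iff_add_eq_0)
  define e where "e n = T1 (1 / (n + \<theta>))" for n
  have e_mem: "e n \<in> k" if "n \<in> k" for n
    unfolding e_def using functional_mem[OF T1 inv_mem[OF that]] .
  have e0: "e 0 = 0" and e1: "e 1 = 1" using T1_0 T1_1 by (simp_all add: e_def)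
  \<comment> \<open>For a common point with ratio \<open>n = \<nu> / \<tau>\<close> and
    \<open>e n \<noteq> 0\<close>, the condition on \<open>T1\<close> forces
    \<open>m / l = (V + T1 1) / e n - n\<close>; then \<open>y / \<tau>\<close> has to be
    \<open>g n\<close>.\<close>
  define g where "g n = (n + \<theta>) / ((V + T1 1) / e n - n - \<theta>)" for n
  have T1_one: "T1 1 \<in> k" using functional_mem[OF T1 K.one_mem] .
  have m_mem: "(V + T1 1) / e n - n \<in> k" if "n \<in> k" for n
    using that e_mem V T1_one by (intro k.diff_mem k.divide_mem k.add_mem)
  have m_ne: "m - \<theta> \<noteq> 0" if "m \<in> k" for m using that \<theta> by auto
  have g_mem: "g n \<in> K" if "n \<in> k" for n
    unfolding g_def using m_mem[OF that] that \<theta> sub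
    by (intro K.divide_mem K.add_mem K.diff_mem[of _ \<theta>]) auto
  have g_ne: "g n \<noteq> 0" if "n \<in> k" for n
    unfolding g_def using shift_ne[OF that] m_ne[OF m_mem[OF that]] by simp
  have "\<exists>T. functional T \<and> T 0 = 0 \<and> T (g 1) = 1"
    using g_mem g_ne k.one_mem K.zero_mem by (intro exists_functional) auto
  then obtain T2 where T2: "functional T2" and T2_1: "T2 (g 1) = 1" by blast
  \<comment> \<open>A common point would satisfy \<open>u * n + v = D n\<close>. If
    \<open>e n = 0\<close>, it has \<open>y = 0\<close> and hence \<open>u * n + v = 0\<close>,
    which explains the default value.\<close>
  define D where "D n = (if e n = 0 then 0 else T2 (g n))" for n
  have "\<exists>u\<in>k - {0}. \<exists>v\<in>k - {0}. \<forall>n\<in>k - {0}. u * n + v \<noteq> D n"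
    using functional_mem[OF T2 g_mem] k.zero_mem T2_1 e1 by (intro k.avoid_lines) (auto simp: D_def)
  then obtain u v where uv: "u \<in> k" "v \<in> k" "u \<noteq> 0" "v \<noteq> 0"
    and avoid: "\<And>n. n \<in> k \<Longrightarrow> n \<noteq> 0 \<Longrightarrow> u * n + v \<noteq> D n" by blast
  \<comment> \<open>Stated for vectors of the two \<open>k\<close>-subspaces rather than for the
    scaled representatives, so that one computation covers all pairs of pieces.\<close>
  have main: False
    if x: "x \<in> K" "T1 x = V * l" and lm: "l \<in> k" "m \<in> k" and nz: "(x, l, m) \<noteq> (0, 0, 0)"
      and y: "y \<in> K" "T2 y = u * \<nu> + v * \<tau>" and nt: "\<nu> \<in> k" "\<tau> \<in> k"
      and eq: "x = c * \<tau>" "l = c * y" "m = c * (\<theta> * y + \<nu> + \<theta> * \<tau>)"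
    for x l m y \<nu> \<tau> c
  proof -
    have c: "c \<noteq> 0" using nz eq by auto
    have cs: "m - \<theta> * l = c * (\<nu> + \<theta> * \<tau>)" using eq by (simp add: algebra_simps)
    show False
    proof (cases "\<tau> = 0")
      case True
      then have "V * l = 0" using x eq functional_zero[OF T1] by simp
      then have "y = 0" using V eq c by simp
      then have "\<nu> = 0" using y uv True functional_zero[OF T2] by simp
      then show False using nz eq True \<open>y = 0\<close> by simp
    next
      case \<tau>: False
      define n where "n = \<nu> / \<tau>"
      have n: "n \<in> k" and \<nu>: "\<nu> = n * \<tau>" using nt \<tau> by (auto simp: n_def k.divide_mem)
      have cs': "m - \<theta> * l = x * (n + \<theta>)" using cs eq \<nu> by (simp add: algebra_simps)
      \<comment> \<open>Since \<open>m - \<theta> * l = (m + n * l) - l * (n + \<theta>)\<close>,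
        division by \<open>n + \<theta>\<close> writes \<open>x\<close> as a
        \<open>k\<close>-combination of \<open>1 / (n + \<theta>)\<close> and 1, to which
        \<open>T1\<close> applies.\<close>
      have "x = (m + n * l) * (1 / (n + \<theta>)) - l * 1"
        using cs' shift_ne[OF n] by (simp add: field_simps)
      then have "T1 x = (m + n * l) * e n - l * T1 1"
        unfolding e_def using inv_mem[OF n] lm n sub K.mult_mem K.one_mem k.add_mem k.mult_mem
        by (simp only: functional_diff[OF T1] functional_scale[OF T1] subset_iff)
      then have A: "(m + n * l) * e n = l * (V + T1 1)" using x by (simp add: algebra_simps)
      have T2y: "T2 y = \<tau> * (u * n + v)" using y \<nu> by (simp add: algebra_simps)
      show False
      proof (cases "e n = 0")
        case True
        then have "y = 0" using A V eq c by simp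
        then have "u * n + v = 0" using T2y \<tau> functional_zero[OF T2] by simp
        then show False using uv avoid[OF n] True by (cases "n = 0") (auto simp: D_def)
      next
        case False
        then have n0: "n \<noteq> 0" using e0 by auto
        have l0: "l \<noteq> 0"
        proof
          assume "l = 0"
          then have "m = 0" using A False by simp
          then show False using nz cs' \<open>l = 0\<close> shift_ne[OF n] by simp
        qed
        have "m / l - \<theta> = (V + T1 1) / e n - n - \<theta>" using A False l0 by (simp add: field_simps)
        then have m: "g n = (n + \<theta>) / (m / l - \<theta>)" by (simp add: g_def)
        have "m / l - \<theta> = x * (n + \<theta>) / l" using cs' l0 by (simp add: field_simps)
        then have "\<tau> * g n = \<tau> * l / x" using m shift_ne[OF n] by simp
        also have "\<dots> = y" using eq c \<tau> by simp
        finally have "T2 y = \<tau> * T2 (g n)" using functional_scale[OF T2 nt(2) g_mem[OF n]] by simp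
        then have "u * n + v = D n" using T2y \<tau> False by (simp add: D_def)
        then show False using avoid[OF n n0] by simp
      qed
    qed
  qed
  have disj: "(x, l, m) \<noteq> (c * x', c * y', c * z')"
    if a: "(x, l, m) \<in> block1 T1 V" and b: "(x', y', z') \<in> block2 T2 u v \<theta>" for x l m x' y' z' c
  proof
    assume eq: "(x, l, m) = (c * x', c * y', c * z')"
    \<comment> \<open>The vertex \<open>(1, 0, 0)\<close> enters the first subspace after scaling by
      \<open>1 / \<theta>\<close>, which \<open>T1\<close> kills; the other representatives are in
      it already.\<close>
    have 1: "\<exists>d. d \<noteq> 0 \<and> d * x \<in> K \<and> T1 (d * x) = V * (d * l) \<and> d * l \<in> k \<and> d * m \<in> k \<and> (x, l, m) \<noteq> (0, 0, 0)"
      using a unfolding block1_def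
    proof (elim insertE UnE imageE)
      assume "(x, l, m) = (1, 0, 0)"
      then show ?thesis
        using T1_0 inv_mem[OF k.zero_mem] shift_ne[OF k.zero_mem] k.zero_mem
        by (intro exI[of _ "1 / (0 + \<theta>)"]) auto
    qed (auto simp: fibre_def intro!: exI[of _ 1] k.closed)
    \<comment> \<open>A nonzero kernel element scales the vertex \<open>(0, 1, \<theta>)\<close>
      into the second subspace.\<close>
    obtain y0 where y0: "y0 \<in> K" "T2 y0 = 0" "y0 \<noteq> 0"
      using nontrivial_kernel[OF T2 g_mem[OF k.one_mem] T2_1 less] by blast
    have 2: "\<exists>d \<nu>. d \<noteq> 0 \<and> d * y' \<in> K \<and> T2 (d * y') = u * \<nu> + v * (d * x') \<and> \<nu> \<in> k \<and> d * x' \<in> k \<and>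
        d * z' = \<theta> * (d * y') + \<nu> + \<theta> * (d * x')"
      using b unfolding block2_def
    proof (elim insertE UnE imageE)
      assume "(x', y', z') = (0, 1, \<theta>)"
      then show ?thesis using y0 k.zero_mem by (intro exI[of _ y0] exI[of _ 0]) auto
    next
      fix t assume "(x', y', z') = (\<lambda>(n, y). (1, y, \<theta> * y + n + \<theta>)) t"
        "t \<in> (SIGMA n:k. fibre T2 (u * n + v))"
      then show ?thesis by (intro exI[of _ 1] exI[of _ "fst t"]) (auto simp: fibre_def k.closed)
    next
      fix y assume "(x', y', z') = (0, y, \<theta> * y + 1)" "y \<in> fibre T2 u"
      then show ?thesis by (intro exI[of _ 1]) (auto simp: fibre_def k.closed)
    qed
    obtain d where d: "d \<noteq> 0" "d * x \<in> K" "T1 (d * x) = V * (d * l)" "d * l \<in> k" "d * m \<in> k"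
      "(x, l, m) \<noteq> (0, 0, 0)" using 1 by blast
    obtain d' \<nu> where d': "d' \<noteq> 0" "d' * y' \<in> K" "T2 (d' * y') = u * \<nu> + v * (d' * x')" "\<nu> \<in> k" "d' * x' \<in> k"
      "d' * z' = \<theta> * (d' * y') + \<nu> + \<theta> * (d' * x')" using 2 by blast
    have "d * x = d * c / d' * (d' * x')" "d * l = d * c / d' * (d' * y')"
      "d * m = d * c / d' * (\<theta> * (d' * y') + \<nu> + \<theta> * (d' * x'))"
      using eq d'(1) unfolding d'(6)[symmetric] by auto
    moreover have "(d * x, d * l, d * m) \<noteq> (0, 0, 0)" using d by auto
    ultimately show False using main[OF d(2-5) _ d'(2-5)] by blast
  qed
  show ?thesis using T1 inv_mem[OF k.one_mem] T1_1 T2 g_mem[OF k.one_mem] T2_1 V uv \<theta> disj by blast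
qed

text \<open>Handles vectors proportional to a single point, since two distinct points with nonzero
  coefficients are wanted. Adding a kernel element \<open>d\<close> to the first coordinate of a
  point other than the vertex stays in the set and adds \<open>d\<close> times the vertex
  \<open>(1, 0, 0)\<close>; this relation can be solved for any of its three points.\<close>

lemma block1_split:
  assumes T: "functional T" and w: "w \<in> K" "T w = 1" and less: "k \<noteq> K"
    and a: "(x, y, z) \<in> block1 T V"
  shows "\<exists>p\<in>block1 T V. \<exists>p'\<in>block1 T V. \<exists>c c'. p \<noteq> p' \<and> c \<noteq> 0 \<and> c' \<noteq> 0 \<and>
    x = c * fst p + c' * fst p' \<and> y = c * fst (snd p) + c' * fst (snd p') \<and> z = c * snd (snd p) + c' * snd (snd p')"
proof -
  obtain d where d: "d \<in> K" "T d = 0" "d \<noteq> 0" using nontrivial_kernel[OF T w less] by blast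
  have V1: "(1, 0, 0) \<in> block1 T V" by (simp add: block1_def)
  have shift: "x + d \<in> fibre T c" if "x \<in> fibre T c" for x c
    using that d by (auto simp: fibre_def functional_add[OF T] K.add_mem)
  from a show ?thesis
    unfolding block1_def
  proof (elim insertE UnE imageE, fold block1_def)
    assume "(x, y, z) = (1, 0, 0)"
    moreover have "0 \<in> fibre T 0" using functional_zero[OF T] K.zero_mem by (simp add: fibre_def)
    then have "(0, 0, 1) \<in> block1 T V" "(0 + d, 0, 1) \<in> block1 T V"
      using shift unfolding block1_def by blast+
    ultimately show ?thesis using d
      by (intro bexI[of _ "(0 + d, 0, 1)"] bexI[of _ "(0, 0, 1)"] exI[of _ "1 / d"] exI[of _ "- 1 / d"]) auto
  next
    fix t assume t: "(x, y, z) = (\<lambda>(x, m). (x, 1, m)) t" "t \<in> fibre T V \<times> k"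
    then have "(x + d, 1, z) \<in> block1 T V" using shift unfolding block1_def by force
    then show ?thesis using d t V1
      by (intro bexI[of _ "(x + d, 1, z)"] bexI[of _ "(1, 0, 0)"] exI[of _ "1"] exI[of _ "- d"]) auto
  next
    fix t assume t: "(x, y, z) = (t, 0, 1)" "t \<in> fibre T 0"
    then have "(x + d, 0, 1) \<in> block1 T V" using shift unfolding block1_def by force
    then show ?thesis using d t V1
      by (intro bexI[of _ "(x + d, 0, 1)"] bexI[of _ "(1, 0, 0)"] exI[of _ "1"] exI[of _ "- d"]) auto
  qed
qed

text \<open>The same relation along the second vertex: \<open>y\<close> grows by \<open>d\<close>
  and the third coordinate by \<open>\<theta> * d\<close>, which adds \<open>d\<close> times
  \<open>(0, 1, \<theta>)\<close>.\<close>

lemma block2_split: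
  assumes T: "functional T" and w: "w \<in> K" "T w = 1" and less: "k \<noteq> K" and u: "u \<in> k"
    and a: "(x, y, z) \<in> block2 T u v \<theta>"
  shows "\<exists>p\<in>block2 T u v \<theta>. \<exists>p'\<in>block2 T u v \<theta>. \<exists>c c'. p \<noteq> p' \<and> c \<noteq> 0 \<and> c' \<noteq> 0 \<and>
    x = c * fst p + c' * fst p' \<and> y = c * fst (snd p) + c' * fst (snd p') \<and> z = c * snd (snd p) + c' * snd (snd p')"
proof -
  obtain d where d: "d \<in> K" "T d = 0" "d \<noteq> 0" using nontrivial_kernel[OF T w less] by blast
  have V2: "(0, 1, \<theta>) \<in> block2 T u v \<theta>" by (simp add: block2_def)
  have shift: "x + d \<in> fibre T c" if "x \<in> fibre T c" for x c
    using that d by (auto simp: fibre_def functional_add[OF T] K.add_mem)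
  from a show ?thesis
    unfolding block2_def
  proof (elim insertE UnE imageE, fold block2_def)
    assume "(x, y, z) = (0, 1, \<theta>)"
    moreover have *: "u * w \<in> fibre T u"
      using functional_scale[OF T u w(1)] u w sub K.mult_mem by (auto simp: fibre_def)
    then have "(0, u * w, \<theta> * (u * w) + 1) \<in> block2 T u v \<theta>"
      "(0, u * w + d, \<theta> * (u * w + d) + 1) \<in> block2 T u v \<theta>"
      using shift unfolding block2_def by blast+
    ultimately show ?thesis using d
      by (intro bexI[of _ "(0, u * w + d, \<theta> * (u * w + d) + 1)"] bexI[of _ "(0, u * w, \<theta> * (u * w) + 1)"]
          exI[of _ "1 / d"] exI[of _ "- 1 / d"]) (auto simp: field_simps)
  next
    fix t assume t: "(x, y, z) = (\<lambda>(n, y). (1, y, \<theta> * y + n + \<theta>)) t" "t \<in> (SIGMA n:k. fibre T (u * n + v))"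
    then have "(1, y + d, \<theta> * (y + d) + fst t + \<theta>) \<in> block2 T u v \<theta>" using shift unfolding block2_def by force
    then show ?thesis using d t V2
      by (intro bexI[of _ "(1, y + d, \<theta> * (y + d) + fst t + \<theta>)"] bexI[of _ "(0, 1, \<theta>)"] exI[of _ "1"] exI[of _ "- d"])
        (auto simp: algebra_simps)
  next
    fix t assume t: "(x, y, z) = (0, t, \<theta> * t + 1)" "t \<in> fibre T u"
    then have "(0, y + d, \<theta> * (y + d) + 1) \<in> block2 T u v \<theta>" using shift unfolding block2_def by force
    moreover have "(0, y + d, \<theta> * (y + d) + 1) \<noteq> (0, 1, \<theta>)" by auto
    ultimately show ?thesis using d t V2
      by (intro bexI[of _ "(0, y + d, \<theta> * (y + d) + 1)"] bexI[of _ "(0, 1, \<theta>)"] exI[of _ "1"] exI[of _ "- d"])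
       (simp_all add: distrib_left)
  qed
qed

text \<open>\<open>F\<close> has only \<open>card K ^ 2\<close> elements, so each vector over
  \<open>F\<close> with three coordinates is annihilated by a nonzero form with coefficients in
  \<open>K\<close>. Both blocking sets meet the plane of that form, in points that are not
  proportional and therefore span it over \<open>F\<close>.\<close>

theorem saturating_set:
  assumes k3: "card k \<ge> 3" and less: "k \<noteq> K" and q: "CARD('a) = card K ^ 2"
  shows "\<exists>B :: ('a \<times> 'a \<times> 'a) set. 3 \<le> card B \<and> card B \<le> 2 * (card K + card K div card k + 1) \<and>
    (\<forall>x y z. (x, y, z) \<noteq> (0, 0, 0) \<longrightarrow> (\<exists>p\<in>B. \<exists>p'\<in>B. \<exists>c c'. p \<noteq> p' \<and> c \<noteq> 0 \<and> c' \<noteq> 0 \<and>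
      x = c * fst p + c' * fst p' \<and> y = c * fst (snd p) + c' * fst (snd p') \<and> z = c * snd (snd p) + c' * snd (snd p')))"
proof -
  obtain T1 T2 w1 w2 V u v \<theta> where T1: "functional T1" and w1: "w1 \<in> K" "T1 w1 = 1"
    and T2: "functional T2" and w2: "w2 \<in> K" "T2 w2 = 1"
    and mem: "V \<in> k" "u \<in> k" "v \<in> k" "\<theta> \<in> K"
    and disj: "\<And>x y z x' y' z' c. (x, y, z) \<in> block1 T1 V \<Longrightarrow> (x', y', z') \<in> block2 T2 u v \<theta> \<Longrightarrow>
      (x, y, z) \<noteq> (c * x', c * y', c * z')"
    using disjoint_blocking_sets[OF k3 less] by blast
  let ?B1 = "block1 T1 V" and ?B2 = "block2 T2 u v \<theta>"
  let ?B = "?B1 \<union> ?B2"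
  have ker: "card (fibre T 0) = card K div card k" if "functional T" "w \<in> K" "T w = 1" for T w
    using card_kernel[OF that] k3 by (metis div_mult_self_is_m less_le_trans zero_less_numeral)
  define M where "M = card K + card K div card k + 1"
  have "card ?B1 \<le> M" using card_block1[OF T1 w1 mem(1)] by (simp add: ker[OF T1 w1] M_def)
  moreover have "card ?B2 \<le> M" using card_block2[OF T2 w2 mem(2,3), of \<theta>] by (simp add: ker[OF T2 w2] M_def)
  moreover have "card ?B \<le> card ?B1 + card ?B2" by (rule card_Un_le)
  ultimately have le: "card ?B \<le> 2 * (card K + card K div card k + 1)"
    unfolding M_def[symmetric] by linarith
  \<comment> \<open>Three explicit points; the colouring of the slopes later asks for at least three
    columns.\<close>
  obtain d where d: "d \<in> K" "T1 d = 0" "d \<noteq> 0" using nontrivial_kernel[OF T1 w1 less] by blast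
  have "0 \<in> fibre T1 0" "d \<in> fibre T1 0" using functional_zero[OF T1] K.zero_mem d by (simp_all add: fibre_def)
  then have "{(1, 0, 0), (0, 0, 1), (d, 0, 1)} \<subseteq> ?B" unfolding block1_def by blast
  then have "card {(1::'a, 0::'a, 0::'a), (0, 0, 1), (d, 0, 1)} \<le> card ?B" by (intro card_mono) auto
  then have ge: "3 \<le> card ?B" using d by simp
  have rep: "\<exists>p\<in>?B. \<exists>p'\<in>?B. \<exists>c c'. p \<noteq> p' \<and> c \<noteq> 0 \<and> c' \<noteq> 0 \<and>
      x = c * fst p + c' * fst p' \<and> y = c * fst (snd p) + c' * fst (snd p') \<and> z = c * snd (snd p) + c' * snd (snd p')"
    if nz: "(x, y, z) \<noteq> (0, 0, 0)" for x y z
  proof -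
    have "card K > 1" using card_mono[of K "{0, 1}"] K.zero_mem K.one_mem by simp
    then have "CARD('a) < card (K \<times> K \<times> K)"
      unfolding q by (simp add: card_cartesian_product power2_eq_square)
    moreover have "card ((\<lambda>(a, b, c). a * x + b * y + c * z) ` (K \<times> K \<times> K)) \<le> CARD('a)"
      by (intro card_mono) auto
    ultimately have "\<not> inj_on (\<lambda>(a, b, c). a * x + b * y + c * z) (K \<times> K \<times> K)"
      by (intro pigeonhole) simp
    then obtain a b c a' b' c' where abc: "a \<in> K" "b \<in> K" "c \<in> K" "a' \<in> K" "b' \<in> K" "c' \<in> K"
      "(a, b, c) \<noteq> (a', b', c')" "a * x + b * y + c * z = a' * x + b' * y + c' * z"
      unfolding inj_on_def by auto
    define a0 b0 c0 where "a0 = a - a'" and "b0 = b - b'" and "c0 = c - c'"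
    have K0: "a0 \<in> K" "b0 \<in> K" "c0 \<in> K" using abc K.diff_mem by (auto simp: a0_def b0_def c0_def)
    have nz0: "a0 \<noteq> 0 \<or> b0 \<noteq> 0 \<or> c0 \<noteq> 0" using abc(7) by (auto simp: a0_def b0_def c0_def)
    have on0: "a0 * x + b0 * y + c0 * z = 0" using abc(8) by (simp add: a0_def b0_def c0_def algebra_simps)
    obtain x1 y1 z1 where 1: "(x1, y1, z1) \<in> ?B1" "a0 * x1 + b0 * y1 + c0 * z1 = 0"
      using block1_meets_line[OF T1 w1 mem(1) K0] by blast
    obtain x2 y2 z2 where 2: "(x2, y2, z2) \<in> ?B2" "a0 * x2 + b0 * y2 + c0 * z2 = 0"
      using block2_meets_line[OF T2 w2 mem(2-4) K0] by blast
    have np: "\<And>t. (x1, y1, z1) \<noteq> (t * x2, t * y2, t * z2)" using disj[OF 1(1) 2(1)] .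
    have nz2: "(x2, y2, z2) \<noteq> (0, 0, 0)" using 2(1) by (auto simp: block2_def)
    have "\<exists>\<alpha> \<beta>. x = \<alpha> * x1 + \<beta> * x2 \<and> y = \<alpha> * y1 + \<beta> * y2 \<and> z = \<alpha> * z1 + \<beta> * z2"
    proof -
      consider "c0 \<noteq> 0" | "b0 \<noteq> 0" | "a0 \<noteq> 0" using nz0 by blast
      then show ?thesis
      proof cases
        case c: 1
        show ?thesis by (rule plane_spanned[OF c on0 1(2) 2(2) nz2 np])
      next
        case c: 2
        have "\<exists>\<alpha> \<beta>. x = \<alpha> * x1 + \<beta> * x2 \<and> z = \<alpha> * z1 + \<beta> * z2 \<and> y = \<alpha> * y1 + \<beta> * y2"
          by (rule plane_spanned[OF c, of a0 _ c0]) (use on0 1(2) 2(2) nz2 np in \<open>auto simp: algebra_simps\<close>)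
        then show ?thesis by blast
      next
        case 3
        have "\<exists>\<alpha> \<beta>. y = \<alpha> * y1 + \<beta> * y2 \<and> z = \<alpha> * z1 + \<beta> * z2 \<and> x = \<alpha> * x1 + \<beta> * x2"
          by (rule plane_spanned[OF 3, of b0 _ c0]) (use on0 1(2) 2(2) nz2 np in \<open>auto simp: algebra_simps\<close>)
        then show ?thesis by blast
      qed
    qed
    then obtain \<alpha> \<beta> where ab: "x = \<alpha> * x1 + \<beta> * x2" "y = \<alpha> * y1 + \<beta> * y2" "z = \<alpha> * z1 + \<beta> * z2" by blast
    \<comment> \<open>If one coefficient vanishes, the vector is a multiple of one point, which is
      split inside its own blocking set.\<close>
    have "\<alpha> \<noteq> 0 \<or> \<beta> \<noteq> 0" using nz ab by auto
    then consider "\<alpha> \<noteq> 0" "\<beta> \<noteq> 0" | "\<alpha> \<noteq> 0" "\<beta> = 0" | "\<alpha> = 0" "\<beta> \<noteq> 0" by blast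
    then show ?thesis
    proof cases
      case c: 1
      have "(x1, y1, z1) \<noteq> (x2, y2, z2)" using np[of 1] by simp
      then show ?thesis using c ab 1(1) 2(1)
        by (intro bexI[of _ "(x1, y1, z1)"] bexI[of _ "(x2, y2, z2)"] exI[of _ \<alpha>] exI[of _ \<beta>]) auto
    next
      case c: 2
      from block1_split[OF T1 w1 less 1(1)] obtain p p' e e' where
        "p \<in> ?B1" "p' \<in> ?B1" "p \<noteq> p'" "e \<noteq> 0" "e' \<noteq> 0" "x1 = e * fst p + e' * fst p'"
        "y1 = e * fst (snd p) + e' * fst (snd p')" "z1 = e * snd (snd p) + e' * snd (snd p')" by blast
      then show ?thesis using c ab
        by (intro bexI[of _ p] bexI[of _ p'] exI[of _ "\<alpha> * e"] exI[of _ "\<alpha> * e'"]) (auto simp: algebra_simps)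
    next
      case c: 3
      from block2_split[OF T2 w2 less mem(2) 2(1)] obtain p p' e e' where
        "p \<in> ?B2" "p' \<in> ?B2" "p \<noteq> p'" "e \<noteq> 0" "e' \<noteq> 0" "x2 = e * fst p + e' * fst p'"
        "y2 = e * fst (snd p) + e' * fst (snd p')" "z2 = e * snd (snd p) + e' * snd (snd p')" by blast
      then show ?thesis using c ab
        by (intro bexI[of _ p] bexI[of _ p'] exI[of _ "\<beta> * e"] exI[of _ "\<beta> * e'"]) (auto simp: algebra_simps)
    qed
  qed
  show ?thesis using ge le rep by blast
qed

end

section \<open>Subfields of a finite field\<close>

text \<open>Translation by 1 permutes the ring, so adding 1 to each of the \<open>CARD('a)\<close>
  summands leaves the sum of all elements unchanged.\<close>

lemma of_nat_card_eq_0: "of_nat CARD('a::{ring_1,finite}) = (0 :: 'a)"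
proof -
  have "(\<Sum>x\<in>UNIV. x + 1) = (\<Sum>x\<in>(UNIV :: 'a set). x)"
    by (rule sum.reindex_bij_witness[of _ "\<lambda>x. x - 1" "\<lambda>x. x + 1"]) auto
  then show ?thesis by (simp add: sum.distrib)
qed

lemma prime_CHAR: "Factorial_Ring.prime CHAR('a::{field,finite})"
  by (intro prime_CHAR_semidom finite_imp_CHAR_pos) simp

lemma CHAR_of_card_prime_power:
  assumes "Factorial_Ring.prime p" and "CARD('a::{field,finite}) = p ^ m"
  shows "CHAR('a) = p"
proof -
  have "CHAR('a) dvd p ^ m" using of_nat_card_eq_0[where ?'a = 'a] assms(2) of_nat_eq_0_iff_char_dvd by metis
  moreover have pc: "Factorial_Ring.prime CHAR('a)" by (rule prime_CHAR)
  ultimately have "CHAR('a) dvd p" using prime_dvd_power by blast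
  then show ?thesis using assms(1) pc primes_dvd_imp_eq by blast
qed

lemma power_card_minus_1:
  fixes x :: "'a::{field,finite}"
  assumes "x \<noteq> 0"
  shows "x ^ (CARD('a) - 1) = 1"
proof -
  have "(\<Prod>y\<in>UNIV - {0}. x * y) = (\<Prod>y\<in>UNIV - {0}. y)"
    by (rule prod.reindex_bij_witness[of _ "\<lambda>y. y / x" "\<lambda>y. x * y"]) (use assms in auto)
  then have "x ^ card (UNIV - {0 :: 'a}) * (\<Prod>y\<in>UNIV - {0}. y) = (\<Prod>y\<in>UNIV - {0 :: 'a}. y)"
    by (simp add: prod.distrib)
  moreover have "(\<Prod>y\<in>UNIV - {0 :: 'a}. y) \<noteq> 0" by simp
  ultimately show ?thesis by (simp add: card_Diff_singleton)
qed

text \<open>For \<open>m\<close> a power of the characteristic this is the fixed field of a power of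
  the Frobenius map; if also \<open>m > 1\<close> and \<open>m - 1\<close> divides
  \<open>CARD('a) - 1\<close>, it is the subfield of order \<open>m\<close>.\<close>

definition power_fixed :: "nat \<Rightarrow> 'a::field set" where
  "power_fixed m = {x. x ^ m = x}"

lemma subfield_power_fixed:
  assumes "CHAR('a::{field,finite}) = p" and "m = p ^ e"
  shows "subfield_set (power_fixed m :: 'a set)"
proof
  have p: "Factorial_Ring.prime p" using prime_CHAR[where ?'a = 'a] assms(1) by simp
  have m0: "m > 0" using p assms(2) by (simp add: prime_gt_0_nat)
  have add: "(x + y) ^ m = x ^ m + y ^ m" for x y :: 'a
    using freshmans_dream'[OF prime_CHAR, of m e x y] assms by simp
  show "(1 :: 'a) \<in> power_fixed m" by (simp add: power_fixed_def)
  show "x - y \<in> power_fixed m" if "x \<in> power_fixed m" "y \<in> power_fixed m" for x y :: 'a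
  proof -
    have "(x - y) ^ m + y ^ m = x ^ m" using add[of "x - y" y] by simp
    then show ?thesis using that by (simp add: power_fixed_def eq_diff_eq)
  qed
  show "x * y \<in> power_fixed m" if "x \<in> power_fixed m" "y \<in> power_fixed m" for x y :: 'a
    using that by (simp add: power_fixed_def power_mult_distrib)
  show "inverse x \<in> power_fixed m" if "x \<in> power_fixed m" for x :: 'a
    using that by (simp add: power_fixed_def power_inverse)
qed

(* X^(q-1) - 1 has q - 1 roots and is divisible by X^(m-1) - 1, which therefore splits as well. *)
lemma card_power_fixed:
  assumes dvd: "m - 1 dvd CARD('a::{field,finite}) - 1" and m: "m > 1"
  shows "card (power_fixed m :: 'a set) = m"
proof -
  let ?q = "CARD('a)"
  obtain c where c: "?q - 1 = (m - 1) * c" using dvd by auto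
  have q: "?q > 1" using card_mono[of UNIV "{0, 1 :: 'a}"] by simp
  then have c0: "c > 0" using c by (cases c) auto
  let ?R = "{x :: 'a. x ^ (m - 1) = 1}"
  define f :: "'a poly" where "f = monom 1 (m - 1) - 1"
  \<comment> \<open>The cofactor: with \<open>q - 1 = (m - 1) * c\<close> the geometric sum gives
    \<open>f * g = X ^ (q - 1) - 1\<close>, so every nonzero element that is not a root of
    \<open>g\<close> is a root of \<open>f\<close>.\<close>
  define g :: "'a poly" where "g = (\<Sum>i<c. monom 1 ((m - 1) * i))"
  have df: "degree f = m - 1"
    using m degree_add_eq_left[of "- 1" "monom 1 (m - 1) :: 'a poly"] by (simp add: f_def degree_monom_eq)
  have pf: "poly f x = x ^ (m - 1) - 1" for x by (simp add: f_def poly_monom)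
  have pg: "poly g x = (\<Sum>i<c. (x ^ (m - 1)) ^ i)" for x by (simp add: g_def poly_sum poly_monom power_mult)
  have f0: "f \<noteq> 0" using df m by auto
  have g0: "g \<noteq> 0"
  proof
    assume "g = 0"
    then have "poly g 0 = 0" by simp
    moreover have "poly g 0 = 1"
    proof -
      have "(\<Sum>i<c. (0 ^ (m - 1)) ^ i) = (\<Sum>i\<in>{0}. (0 :: 'a) ^ i)"
        using m c0 by (intro sum.mono_neutral_cong_right) auto
      then show ?thesis unfolding pg by simp
    qed
    ultimately show False by simp
  qed
  have "degree g \<le> (m - 1) * (c - 1)"
    unfolding g_def by (intro degree_sum_le) (auto intro!: order.trans[OF degree_monom_le])
  then have "card {x. poly g x = 0} \<le> (m - 1) * (c - 1)" using card_poly_roots_bound[OF g0] le_trans by blast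
  moreover have "UNIV - {0 :: 'a} \<subseteq> ?R \<union> {x. poly g x = 0}"
  proof
    fix x :: 'a assume "x \<in> UNIV - {0}"
    then have "x ^ (?q - 1) = 1" using power_card_minus_1[of x] by blast
    then have "(x ^ (m - 1)) ^ c = 1" unfolding c power_mult .
    then have "poly f x * poly g x = 0"
      unfolding pf pg power_diff_1_eq[symmetric] by simp
    then show "x \<in> ?R \<union> {x. poly g x = 0}" by (auto simp: pf)
  qed
  then have "card (UNIV - {0 :: 'a}) \<le> card (?R \<union> {x. poly g x = 0})" by (intro card_mono) auto
  then have "?q - 1 \<le> card ?R + card {x. poly g x = 0}"
    using card_Un_le[of ?R "{x. poly g x = 0}"] by (simp add: card_Diff_singleton)
  ultimately have "(m - 1) * c \<le> card ?R + (m - 1) * (c - 1)" using c by linarith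
  then have ge: "m - 1 \<le> card ?R" using c0 by (cases c) auto
  have "?R = {x. poly f x = 0}" by (auto simp: pf)
  then have "card ?R \<le> m - 1" using card_poly_roots_bound[OF f0] df by simp
  moreover have "power_fixed m = insert 0 ?R"
  proof -
    have "x ^ m = x \<longleftrightarrow> x = 0 \<or> x ^ (m - 1) = 1" for x :: 'a
    proof -
      have "x ^ m = x * x ^ (m - 1)" using m by (cases m) auto
      then show ?thesis using m by auto
    qed
    then show ?thesis by (auto simp: power_fixed_def)
  qed
  moreover have "(0::'a) \<notin> ?R" using m by (simp add: power_0_left)
  ultimately show ?thesis using ge m by simp
qed

lemma power_fixed_subset:
  assumes "m - 1 dvd s - 1" and "s > 0" and "m > 1"
  shows "power_fixed m \<subseteq> (power_fixed s :: 'a::field set)"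
proof
  fix x :: 'a assume x: "x \<in> power_fixed m"
  show "x \<in> power_fixed s"
  proof (cases "x = 0")
    case False
    have m: "Suc (m - 1) = m" and s: "Suc (s - 1) = s" using assms by auto
    have "x * x ^ (m - 1) = x" using x unfolding power_fixed_def power_Suc[symmetric] m by simp
    then have "x ^ (m - 1) = 1" using False by simp
    moreover obtain c where "s - 1 = (m - 1) * c" using assms(1) by auto
    ultimately have "x ^ (s - 1) = 1" by (simp add: power_mult)
    then have "x * x ^ (s - 1) = x" by simp
    then show ?thesis unfolding power_fixed_def power_Suc[symmetric] s by simp
  qed (use assms in \<open>simp add: power_fixed_def\<close>)
qed

text \<open>Lagrange's theorem in the additive and in the multiplicative group of the field.\<close>

lemma subfield_card:
  fixes F :: "('b, 'c) ring_scheme"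
  assumes F: "field F" and fin: "finite (carrier F)" and K: "subfield K F"
  shows "card K dvd card (carrier F)" and "card K - 1 dvd card (carrier F) - 1"
proof -
  interpret F: field F by fact
  have KF: "K \<subseteq> carrier F" using subfieldE(3)[OF K] .
  have "subgroup K (add_monoid F)"
    using subring.axioms(1)[OF subfieldE(1)[OF K]] .
  then have "card K dvd Coset.order (add_monoid F)" using F.add.lagrange by (metis dvd_triv_right)
  then show "card K dvd card (carrier F)" by (simp add: Coset.order_def)
  have "subgroup (K - {\<zero>\<^bsub>F\<^esub>}) (mult_of F)" using F.subgroup_mult_of[OF K] .
  then have "card (K - {\<zero>\<^bsub>F\<^esub>}) dvd Coset.order (mult_of F)"
    using group.lagrange[OF F.field_mult_group] by (metis dvd_triv_right)
  then have "card (K - {\<zero>\<^bsub>F\<^esub>}) dvd card (carrier F - {\<zero>\<^bsub>F\<^esub>})" by (simp add: Coset.order_def)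
  moreover have "\<zero>\<^bsub>F\<^esub> \<in> K" using subringE(2)[OF subfieldE(1)[OF K]] .
  ultimately show "card K - 1 dvd card (carrier F) - 1" using fin KF by (simp add: card_Diff_singleton)
qed

section \<open>Lifting by slopes\<close>

text \<open>Slopes are the \<open>q + 1\<close> points of the projective line over \<open>F\<close>,
  \<open>None\<close> being the infinite slope. Together with \<open>slope_snd\<close> this
  parametrises the line of slope \<open>b\<close> through the origin by
  \<open>\<xi>\<close>.\<close>

definition slope_fst :: "'a::field option \<Rightarrow> 'a \<Rightarrow> 'a" where
  "slope_fst b \<xi> = (case b of None \<Rightarrow> 0 | Some c \<Rightarrow> \<xi>)"

definition slope_snd :: "'a::field option \<Rightarrow> 'a \<Rightarrow> 'a" where
  "slope_snd b \<xi> = (case b of None \<Rightarrow> \<xi> | Some c \<Rightarrow> c * \<xi>)"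

lemma slope_zero [simp]: "slope_fst b 0 = 0" "slope_snd b 0 = 0"
  by (simp_all add: slope_fst_def slope_snd_def split: option.split)

lemma slope_mult: "slope_fst b (c * \<xi>) = c * slope_fst b \<xi>" "slope_snd b (c * \<xi>) = c * slope_snd b \<xi>"
  by (simp_all add: slope_fst_def slope_snd_def split: option.split)

text \<open>Two lines of different slopes through the origin together span the plane.\<close>

lemma slopes_transversal:
  assumes "b \<noteq> b'" and a: "a \<noteq> 0" "a' \<noteq> 0"
  shows "\<exists>\<xi> \<xi>'. a * slope_fst b \<xi> + a' * slope_fst b' \<xi>' = x \<and> a * slope_snd b \<xi> + a' * slope_snd b' \<xi>' = y"
proof (cases b)
  case None
  then obtain c where "b' = Some c" using assms by (cases b') auto
  then show ?thesis using None a
    by (intro exI[of _ "(y - c * x) / a"] exI[of _ "x / a'"]) (simp add: slope_fst_def slope_snd_def)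
next
  case (Some c)
  show ?thesis
  proof (cases b')
    case None
    then show ?thesis using Some a
      by (intro exI[of _ "x / a"] exI[of _ "(y - c * x) / a'"]) (simp add: slope_fst_def slope_snd_def)
  next
    case c': (Some c')
    then have ne: "c - c' \<noteq> 0" using assms Some by simp
    \<comment> \<open>The solution of \<open>u + w = x\<close> and
      \<open>c * u + c' * w = y\<close>.\<close>
    define u w where "u = (y - c' * x) / (c - c')" and "w = (c * x - y) / (c - c')"
    have uw: "(c - c') * u = y - c' * x" "(c - c') * w = c * x - y" using ne by (simp_all add: u_def w_def)
    have "(c - c') * (u + w) = (c - c') * x" unfolding distrib_left uw by (simp add: algebra_simps)
    then have 1: "u + w = x" using ne by simp
    have "c * u + c' * w = (c - c') * u + c' * (u + w)" by (simp add: algebra_simps)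
    then have 2: "c * u + c' * w = y" unfolding uw 1 by simp
    show ?thesis using Some c' a 1 2
      by (intro exI[of _ "u / a"] exI[of _ "w / a'"]) (simp add: slope_fst_def slope_snd_def)
  qed
qed

lemma slope_exists: "\<exists>b \<xi>. slope_fst b \<xi> = x \<and> slope_snd b \<xi> = y"
proof (cases "x = 0")
  case True
  then show ?thesis by (intro exI[of _ None] exI[of _ y]) (simp add: slope_fst_def slope_snd_def)
next
  case False
  then show ?thesis by (intro exI[of _ "Some (y / x)"] exI[of _ x]) (simp add: slope_fst_def slope_snd_def)
qed

text \<open>Vectors are functions read only on an initial segment, so the two coordinates at
  positions \<open>d\<close> and \<open>Suc d\<close> are appended by updating them.\<close>

definition extend :: "nat \<Rightarrow> (nat \<Rightarrow> 'a::field) \<Rightarrow> 'a option \<Rightarrow> 'a \<Rightarrow> nat \<Rightarrow> 'a" where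
  "extend d g b \<xi> = g(d := slope_fst b \<xi>, Suc d := slope_snd b \<xi>)"

lemma extend_combination:
  "(\<forall>l<Suc (Suc d). v l = a * extend d g b \<xi> l + a' * extend d g' b' \<xi>' l) \<longleftrightarrow>
   (\<forall>l<d. v l = a * g l + a' * g' l) \<and>
   v d = a * slope_fst b \<xi> + a' * slope_fst b' \<xi>' \<and> v (Suc d) = a * slope_snd b \<xi> + a' * slope_snd b' \<xi>'"
  by (auto simp: extend_def less_Suc_eq)

(* The slopes refine a coarser colouring by gamma. A vector is represented by two columns of
   different slopes; unless even their colours differ, both columns lie outside U, so that the
   slopes on U may be changed within their colour at the next level. *)
definition sloped_cover :: "nat \<Rightarrow> ('a::field option \<Rightarrow> nat) \<Rightarrow> 'i set \<Rightarrow> ('i \<Rightarrow> nat \<Rightarrow> 'a) \<Rightarrow>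
    ('i \<Rightarrow> 'a option) \<Rightarrow> 'i set \<Rightarrow> bool" where
  "sloped_cover d \<gamma> J g \<beta> U \<longleftrightarrow> U \<subseteq> J \<and> \<beta> ` U = UNIV \<and>
     (\<forall>v. (\<exists>l<d. v l \<noteq> 0) \<longrightarrow> (\<exists>i\<in>J. \<exists>j\<in>J. \<exists>a b. a \<noteq> 0 \<and> b \<noteq> 0 \<and> \<beta> i \<noteq> \<beta> j \<and>
        (\<gamma> (\<beta> i) \<noteq> \<gamma> (\<beta> j) \<or> i \<notin> U \<and> j \<notin> U) \<and> (\<forall>l<d. v l = a * g i l + b * g j l)))"

lemma sloped_cover_reindex:
  assumes "sloped_cover d \<gamma> J g \<beta> U" and f: "bij_betw f I J"
  shows "sloped_cover d \<gamma> I (g \<circ> f) (\<beta> \<circ> f) {i \<in> I. f i \<in> U}"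
proof -
  have J: "J = f ` I" using f by (simp add: bij_betw_def)
  have "U = f ` {i \<in> I. f i \<in> U}" using assms(1) J unfolding sloped_cover_def by auto
  then have "(\<beta> \<circ> f) ` {i \<in> I. f i \<in> U} = UNIV"
    using assms(1) unfolding sloped_cover_def by (metis image_comp)
  then show ?thesis using assms(1) unfolding sloped_cover_def J by (simp only: bex_simps) auto
qed

text \<open>Over each column of \<open>U\<close> the new columns with parameters 0 and 1 are spent
  on vectors supported in the new coordinates; the remaining parameters form the new stock. The
  change by \<open>\<sigma>\<close> separates the slopes of the spent pair but keeps their colour,
  so the other representations survive.\<close>

lemma sloped_cover_step:
  fixes \<gamma> :: "'a::{field,finite} option \<Rightarrow> nat" and g :: "'i \<Rightarrow> nat \<Rightarrow> 'a"
  assumes S: "sloped_cover d \<gamma> J g \<beta> U" and \<sigma>: "\<And>b. \<sigma> b \<noteq> b" "\<And>b. \<gamma> (\<sigma> b) = \<gamma> b"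
    and q: "CARD('a) > 2"
  shows "\<exists>\<beta>' U'. sloped_cover (Suc (Suc d)) \<gamma> (J \<times> UNIV) (\<lambda>(i, \<xi>). extend d (g i) (\<beta> i) \<xi>) \<beta>' U'"
proof -
  have UJ: "U \<subseteq> J" and Usurj: "\<beta> ` U = UNIV" using S unfolding sloped_cover_def by auto
  have rep: "\<exists>i\<in>J. \<exists>j\<in>J. \<exists>a b. a \<noteq> 0 \<and> b \<noteq> 0 \<and> \<beta> i \<noteq> \<beta> j \<and>
        (\<gamma> (\<beta> i) \<noteq> \<gamma> (\<beta> j) \<or> i \<notin> U \<and> j \<notin> U) \<and> (\<forall>l<d. v l = a * g i l + b * g j l)"
    if "\<exists>l<d. v l \<noteq> 0" for v
    using S that unfolding sloped_cover_def by simp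
  define U' where "U' = U \<times> (UNIV - {0, 1 :: 'a})"
  define \<beta>' where "\<beta>' = (\<lambda>(i, \<xi> :: 'a). if i \<in> U \<and> \<xi> = 0 then \<sigma> (\<beta> i) else \<beta> i)"
  have "UNIV \<noteq> {0, 1 :: 'a}" using q by (metis card_2_iff less_irrefl zero_neq_one)
  then obtain \<xi>0 :: 'a where \<xi>0: "\<xi>0 \<noteq> 0" "\<xi>0 \<noteq> 1" by auto
  have "\<beta>' ` U' = UNIV"
  proof -
    have "b \<in> \<beta>' ` U'" for b
    proof -
      obtain i where "i \<in> U" "\<beta> i = b" using Usurj by (metis UNIV_I imageE)
      then show ?thesis using \<xi>0 by (intro image_eqI[of _ _ "(i, \<xi>0)"]) (auto simp: U'_def \<beta>'_def)
    qed
    then show ?thesis by blast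
  qed
  moreover have "\<exists>i\<in>J \<times> UNIV. \<exists>j\<in>J \<times> UNIV. \<exists>a b. a \<noteq> 0 \<and> b \<noteq> 0 \<and> \<beta>' i \<noteq> \<beta>' j \<and>
      (\<gamma> (\<beta>' i) \<noteq> \<gamma> (\<beta>' j) \<or> i \<notin> U' \<and> j \<notin> U') \<and>
      (\<forall>l<Suc (Suc d). v l = a * (case i of (i, \<xi>) \<Rightarrow> extend d (g i) (\<beta> i) \<xi>) l +
        b * (case j of (i, \<xi>) \<Rightarrow> extend d (g i) (\<beta> i) \<xi>) l)"
    if nz: "\<exists>l<Suc (Suc d). v l \<noteq> 0" for v
  proof (cases "\<exists>l<d. v l \<noteq> 0")
    case True
    obtain i j a b where ij: "i \<in> J" "j \<in> J" "a \<noteq> 0" "b \<noteq> 0" "\<beta> i \<noteq> \<beta> j"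
      "\<gamma> (\<beta> i) \<noteq> \<gamma> (\<beta> j) \<or> i \<notin> U \<and> j \<notin> U" "\<forall>l<d. v l = a * g i l + b * g j l"
      using rep[OF True] by blast
    obtain \<xi> \<xi>' where "a * slope_fst (\<beta> i) \<xi> + b * slope_fst (\<beta> j) \<xi>' = v d"
      "a * slope_snd (\<beta> i) \<xi> + b * slope_snd (\<beta> j) \<xi>' = v (Suc d)"
      using slopes_transversal[OF ij(5,3,4)] by blast
    \<comment> \<open>If the colours differ, they still do after \<open>\<sigma>\<close>; otherwise
      both columns lie outside \<open>U\<close>, where the slopes did not change.\<close>
    moreover have "\<gamma> (\<beta>' (i, \<xi>)) = \<gamma> (\<beta> i)" "\<gamma> (\<beta>' (j, \<xi>')) = \<gamma> (\<beta> j)"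
      using \<sigma> by (auto simp: \<beta>'_def)
    moreover from this have "\<beta>' (i, \<xi>) \<noteq> \<beta>' (j, \<xi>')"
      using ij(5,6) by (auto simp: \<beta>'_def)
    moreover have "\<gamma> (\<beta> i) \<noteq> \<gamma> (\<beta> j) \<or> (i, \<xi>) \<notin> U' \<and> (j, \<xi>') \<notin> U'" using ij(6) by (auto simp: U'_def)
    ultimately show ?thesis using ij
      by (intro bexI[of _ "(i, \<xi>)"] bexI[of _ "(j, \<xi>')"] exI[of _ a] exI[of _ b]) (simp_all add: extend_combination)
  next
    case False
    \<comment> \<open>The two new coordinates determine a slope \<open>b\<close>; in a difference of
      two columns over one \<open>i\<close> of that slope the old parts cancel.\<close>
    obtain b \<xi> where b: "slope_fst b \<xi> = v d" "slope_snd b \<xi> = v (Suc d)" using slope_exists by blast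
    have "v d \<noteq> 0 \<or> v (Suc d) \<noteq> 0" using nz False by (auto simp: less_Suc_eq)
    then have \<xi>: "\<xi> \<noteq> 0" using b by auto
    obtain i where i: "i \<in> U" "\<beta> i = b" using Usurj by (metis UNIV_I imageE)
    have "\<xi> * slope_fst b 1 = v d" "\<xi> * slope_snd b 1 = v (Suc d)"
      using b slope_mult[of b \<xi> 1] by simp_all
    then have "\<forall>l<Suc (Suc d). v l = \<xi> * extend d (g i) (\<beta> i) 1 l + (- \<xi>) * extend d (g i) (\<beta> i) 0 l"
      unfolding extend_combination using False i by simp
    moreover have "\<beta>' (i, 1) \<noteq> \<beta>' (i, 0)" using i \<sigma>(1)[of b] by (auto simp: \<beta>'_def)
    moreover have "(i, 1) \<notin> U'" "(i, 0) \<notin> U'" "(i, 1) \<in> J \<times> UNIV" "(i, 0) \<in> J \<times> UNIV" "- \<xi> \<noteq> 0"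
      using i UJ \<xi> by (auto simp: U'_def)
    ultimately show ?thesis using \<xi>
      by (intro bexI[of _ "(i, 1)"] bexI[of _ "(i, 0)"] exI[of _ \<xi>] exI[of _ "- \<xi>"]
          conjI disjI2) (simp_all only: prod.case simp_thms)
  qed
  ultimately have "sloped_cover (Suc (Suc d)) \<gamma> (J \<times> UNIV) (\<lambda>(i, \<xi>). extend d (g i) (\<beta> i) \<xi>) \<beta>' U'"
    using UJ unfolding sloped_cover_def by (auto simp: U'_def)
  then show ?thesis by blast
qed

text \<open>\<open>\<mu>\<close> provides the slopes of the first lift, \<open>\<beta>\<close> those
  assigned to the lifted columns for the next one. Slopes are listed and coloured by their position
  modulo \<open>M\<close>; the bound on \<open>2 * M\<close> gives each colour at least two
  slopes.\<close>

lemma slope_colouring: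
  fixes M :: nat
  assumes M: "3 \<le> M" "2 * M \<le> CARD('a::{field,finite}) + 1" and q: "CARD('a) \<ge> 5"
  shows "\<exists>(\<gamma> :: 'a option \<Rightarrow> nat) \<sigma> (\<beta> :: nat \<times> 'a \<Rightarrow> 'a option) (\<mu> :: nat \<Rightarrow> 'a option).
    (\<forall>b. \<sigma> b \<noteq> b \<and> \<gamma> (\<sigma> b) = \<gamma> b) \<and> inj_on \<mu> {..<M} \<and> (\<exists>i<M. \<mu> i = None) \<and> (\<exists>i<M. \<mu> i = Some 0) \<and>
    (\<forall>i<M. \<forall>\<xi>. \<gamma> (\<beta> (i, \<xi>)) = i) \<and> (\<forall>i<M. \<beta> (i, 0) \<noteq> \<beta> (i, 1)) \<and>
    \<beta> ` ({..<M} \<times> (UNIV - {0, 1})) = UNIV"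
proof -
  let ?q = "CARD('a)"
  obtain ys :: "'a option list" where ys: "set ys = UNIV - {None, Some 0}" "distinct ys"
    using finite_distinct_list[of "UNIV - {None, Some (0 :: 'a)}"] by auto
  \<comment> \<open>\<open>None\<close> and \<open>Some 0\<close> come first and so are among the
    \<open>M\<close> slopes of \<open>\<mu>\<close>.\<close>
  define xs where "xs = None # Some 0 # ys"
  have xs: "set xs = UNIV" "distinct xs" using ys by (auto simp: xs_def)
  have len: "length xs = ?q + 1"
    using distinct_card[OF xs(2)] xs(1) by (simp add: card_UNIV_option)
  obtain zs :: "'a list" where zs: "set zs = UNIV - {0, 1}" "distinct zs"
    using finite_distinct_list[of "UNIV - {0, 1 :: 'a}"] by auto
  have lz: "length zs = ?q - 2" using distinct_card[OF zs(2)] zs(1) by (simp add: card_Diff_subset)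
  define ix where "ix b = (SOME j. j < length xs \<and> xs ! j = b)" for b
  have ix: "ix b < length xs" "xs ! ix b = b" for b
  proof -
    have "\<exists>j. j < length xs \<and> xs ! j = b" using xs(1) by (metis UNIV_I in_set_conv_nth)
    then have "ix b < length xs \<and> xs ! ix b = b" unfolding ix_def by (rule someI_ex)
    then show "ix b < length xs" "xs ! ix b = b" by auto
  qed
  have ix_nth: "ix (xs ! j) = j" if "j < length xs" for j
    using ix[of "xs ! j"] that nth_eq_iff_index_eq[OF xs(2)] by blast
  define iz where "iz \<xi> = (SOME j. j < length zs \<and> zs ! j = \<xi>)" for \<xi>
  have iz: "iz (zs ! j) = j" if "j < length zs" for j
  proof -
    have "\<exists>i. i < length zs \<and> zs ! i = zs ! j" using that by blast
    then have "iz (zs ! j) < length zs \<and> zs ! iz (zs ! j) = zs ! j" unfolding iz_def by (rule someI_ex)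
    then show ?thesis using that nth_eq_iff_index_eq[OF zs(2)] by blast
  qed
  define \<gamma> where "\<gamma> b = ix b mod M" for b
  \<comment> \<open>The next slope of the same colour, or the first one if there is no next. The
    first one differs from \<open>b\<close>, because an index without successor is at least
    \<open>M\<close>.\<close>
  define \<sigma> where "\<sigma> b = xs ! (if ix b + M < length xs then ix b + M else ix b mod M)" for b
  \<comment> \<open>Parameters 0 and 1 get the first two slopes of colour \<open>i\<close>; the
    other \<open>CARD('a) - 2\<close> parameters run through the whole colour class, with its first
    slope as default once it is exhausted.\<close>
  define \<beta> where "\<beta> = (\<lambda>(i, \<xi>). if \<xi> = 0 then xs ! i else if \<xi> = 1 then xs ! (i + M)
      else if i + M * iz \<xi> < length xs then xs ! (i + M * iz \<xi>) else xs ! i)"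
  have \<gamma>_nth: "\<gamma> (xs ! j) = j mod M" if "j < length xs" for j using ix_nth[OF that] by (simp add: \<gamma>_def)
  have small: "j < length xs" if "j < M" for j using that M len by linarith
  have small2: "j + M < length xs" if "j < M" for j using that M len by linarith
  have Mpos: "0 < M" using M by linarith
  have sig: "\<sigma> b \<noteq> b \<and> \<gamma> (\<sigma> b) = \<gamma> b" for b
  proof (cases "ix b + M < length xs")
    case True
    then have "ix (\<sigma> b) = ix b + M" by (simp add: \<sigma>_def ix_nth)
    then show ?thesis using Mpos unfolding \<gamma>_def by (metis add_cancel_left_right mod_add_self2 not_less0)
  next
    case False
    have "ix b mod M < M" using Mpos by simp
    then have "ix (\<sigma> b) = ix b mod M" using False small by (simp add: \<sigma>_def ix_nth)
    moreover have "M \<le> ix b" using False M len by linarith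
    ultimately show ?thesis using \<open>ix b mod M < M\<close> unfolding \<gamma>_def by (metis mod_mod_trivial not_le)
  qed
  have "inj_on ((!) xs) {..<M}"
    using xs(2) small by (auto simp: inj_on_def nth_eq_iff_index_eq)
  moreover have "xs ! 0 = None" "xs ! 1 = Some 0" by (simp_all add: xs_def)
  then have "\<exists>i<M. xs ! i = None" "\<exists>i<M. xs ! i = Some 0" using M by (auto intro: exI[of _ 0] exI[of _ 1])
  moreover have "\<gamma> (\<beta> (i, \<xi>)) = i" if "i < M" for i \<xi>
    using that small[OF that] small2[OF that] by (simp add: \<beta>_def \<gamma>_nth)
  moreover have "\<beta> (i, 0) \<noteq> \<beta> (i, 1)" if "i < M" for i
    using small[OF that] small2[OF that] nth_eq_iff_index_eq[OF xs(2)] Mpos by (simp add: \<beta>_def)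
  moreover have "\<beta> ` ({..<M} \<times> (UNIV - {0, 1})) = UNIV"
  proof -
    have "b \<in> \<beta> ` ({..<M} \<times> (UNIV - {0, 1}))" for b
    proof -
      let ?j = "ix b"
      \<comment> \<open>The place of a slope within its colour class has to stay below the number
        \<open>?q - 2\<close> of remaining parameters; \<open>M \<ge> 3\<close> and
        \<open>?q \<ge> 5\<close> ensure this.\<close>
      have "?j div M \<le> ?j div 3" using M by (simp add: div_le_mono2)
      also have "\<dots> < length zs" using ix(1)[of b] len lz q by linarith
      finally have l: "?j div M < length zs" .
      then have "zs ! (?j div M) \<in> UNIV - {0, 1}" using zs(1) nth_mem by metis
      moreover have "\<beta> (?j mod M, zs ! (?j div M)) = b"
        using calculation ix[of b] by (simp add: \<beta>_def iz[OF l])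
      ultimately show ?thesis using Mpos by (intro image_eqI[of _ _ "(?j mod M, zs ! (?j div M))"]) auto
    qed
    then show ?thesis by blast
  qed
  ultimately show ?thesis using sig
    by (intro exI[of _ \<gamma>] exI[of _ \<sigma>] exI[of _ \<beta>] exI[of _ "(!) xs"]) (intro conjI; blast)
qed


text \<open>The first lift has one slope per column of \<open>h\<close>, so a vector with zero old
  part need not lie on any of these lines. The slopes \<open>None\<close> and \<open>Some 0\<close>
  occur and serve the two axes; two added unit columns serve the remaining vectors and account for
  the summand 2.\<close>

lemma sloped_cover_base:
  fixes h :: "nat \<Rightarrow> nat \<Rightarrow> 'a::{field,finite}"
  assumes M: "3 \<le> M" "2 * M \<le> CARD('a) + 1" and q: "CARD('a) \<ge> 5"
    and cover: "\<And>v. \<exists>l<d. v l \<noteq> 0 \<Longrightarrow>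
      \<exists>i<M. \<exists>j<M. \<exists>a b. a \<noteq> 0 \<and> b \<noteq> 0 \<and> i \<noteq> j \<and> (\<forall>l<d. v l = a * h i l + b * h j l)"
  shows "\<exists>(\<gamma> :: 'a option \<Rightarrow> nat) \<sigma> J g \<beta> U. (\<forall>b. \<sigma> b \<noteq> b \<and> \<gamma> (\<sigma> b) = \<gamma> b) \<and> finite J \<and> card J = M * CARD('a) + 2 \<and>
    sloped_cover (Suc (Suc d)) \<gamma> (J :: (nat \<times> 'a + bool) set) g \<beta> U"
proof -
  obtain \<gamma> :: "'a option \<Rightarrow> nat" and \<sigma> and \<beta> :: "nat \<times> 'a \<Rightarrow> 'a option" and \<mu> :: "nat \<Rightarrow> 'a option" where
    *: "(\<forall>b. \<sigma> b \<noteq> b \<and> \<gamma> (\<sigma> b) = \<gamma> b) \<and> inj_on \<mu> {..<M} \<and> (\<exists>i<M. \<mu> i = None) \<and> (\<exists>i<M. \<mu> i = Some 0) \<and>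
    (\<forall>i<M. \<forall>\<xi>. \<gamma> (\<beta> (i, \<xi>)) = i) \<and> (\<forall>i<M. \<beta> (i, 0) \<noteq> \<beta> (i, 1)) \<and>
    \<beta> ` ({..<M} \<times> (UNIV - {0, 1})) = UNIV"
    using slope_colouring[OF M q] by (elim exE) (rule that)
  have \<sigma>: "\<forall>b. \<sigma> b \<noteq> b \<and> \<gamma> (\<sigma> b) = \<gamma> b" using * by (elim conjE)
  have \<mu>: "inj_on \<mu> {..<M}" "\<exists>i<M. \<mu> i = None" "\<exists>i<M. \<mu> i = Some 0"
    using * by - (elim conjE, assumption)+
  have \<gamma>: "\<And>i \<xi>. i < M \<Longrightarrow> \<gamma> (\<beta> (i, \<xi>)) = i" using * by (elim conjE) blast
  have ne: "\<And>i. i < M \<Longrightarrow> \<beta> (i, 0) \<noteq> \<beta> (i, 1)" using * by (elim conjE) blast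
  have surj: "\<beta> ` ({..<M} \<times> (UNIV - {0, 1})) = UNIV" using * by (elim conjE)
  define J :: "(nat \<times> 'a + bool) set" where "J = Inl ` ({..<M} \<times> UNIV) \<union> range Inr"
  define U :: "(nat \<times> 'a + bool) set" where "U = Inl ` ({..<M} \<times> (UNIV - {0, 1}))"
  define g :: "nat \<times> 'a + bool \<Rightarrow> nat \<Rightarrow> 'a" where
    "g = case_sum (\<lambda>(i, \<xi>). extend d (h i) (\<mu> i) \<xi>) (\<lambda>c. extend d (\<lambda>_. 0) (if c then Some 0 else None) 1)"
  define \<beta>' where "\<beta>' = case_sum \<beta> (\<lambda>c. if c then Some 0 else None)"
  have UJ: "U \<subseteq> J" by (auto simp: U_def J_def)
  have "\<beta>' ` U = UNIV" using surj by (simp add: U_def \<beta>'_def image_image)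
  moreover have "\<exists>i\<in>J. \<exists>j\<in>J. \<exists>a b. a \<noteq> 0 \<and> b \<noteq> 0 \<and> \<beta>' i \<noteq> \<beta>' j \<and>
        (\<gamma> (\<beta>' i) \<noteq> \<gamma> (\<beta>' j) \<or> i \<notin> U \<and> j \<notin> U) \<and> (\<forall>l<Suc (Suc d). v l = a * g i l + b * g j l)"
    if nz: "\<exists>l<Suc (Suc d). v l \<noteq> 0" for v
  proof (cases "\<exists>l<d. v l \<noteq> 0")
    case True
    obtain i j a b where ij: "i < M" "j < M" "a \<noteq> 0" "b \<noteq> 0" "i \<noteq> j" "\<forall>l<d. v l = a * h i l + b * h j l"
      using cover[OF True] by blast
    have "\<mu> i \<noteq> \<mu> j" using ij \<mu>(1) by (auto simp: inj_on_def)
    then obtain \<xi> \<xi>' where "a * slope_fst (\<mu> i) \<xi> + b * slope_fst (\<mu> j) \<xi>' = v d"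
      "a * slope_snd (\<mu> i) \<xi> + b * slope_snd (\<mu> j) \<xi>' = v (Suc d)"
      using slopes_transversal[OF _ ij(3,4)] by blast
    then have "\<forall>l<Suc (Suc d). v l = a * g (Inl (i, \<xi>)) l + b * g (Inl (j, \<xi>')) l"
      using ij(6) unfolding g_def sum.case prod.case extend_combination by simp
    \<comment> \<open>Columns over different \<open>i\<close> carry different colours, whatever
      their parameters.\<close>
    moreover have "\<gamma> (\<beta>' (Inl (i, \<xi>))) \<noteq> \<gamma> (\<beta>' (Inl (j, \<xi>')))"
      using ij \<gamma> by (simp add: \<beta>'_def)
    moreover from this have "\<beta>' (Inl (i, \<xi>)) \<noteq> \<beta>' (Inl (j, \<xi>'))" by auto
    moreover have "Inl (i, \<xi>) \<in> J" "Inl (j, \<xi>') \<in> J" using ij by (auto simp: J_def)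
    ultimately show ?thesis using ij(3,4) by blast
  next
    case z: False
    have single: ?thesis if i: "i < M" and s: "v d = slope_fst (\<mu> i) \<xi>" "v (Suc d) = slope_snd (\<mu> i) \<xi>" for i \<xi>
    proof -
      have \<xi>: "\<xi> \<noteq> 0" using s nz z by (auto simp: less_Suc_eq)
      have "\<forall>l<Suc (Suc d). v l = \<xi> * g (Inl (i, 1)) l + (- \<xi>) * g (Inl (i, 0)) l"
        using s z slope_mult[of "\<mu> i" \<xi> 1] unfolding g_def sum.case prod.case extend_combination by simp
      moreover have "\<beta>' (Inl (i, 1)) \<noteq> \<beta>' (Inl (i, 0))" using ne[OF i] by (simp add: \<beta>'_def)
      moreover have "Inl (i, 1) \<in> J" "Inl (i, 0) \<in> J" "Inl (i, 1) \<notin> U" "Inl (i, 0) \<notin> U" "- \<xi> \<noteq> 0"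
        using i \<xi> by (auto simp: J_def U_def)
      ultimately show ?thesis using \<xi> by blast
    qed
    consider "v d = 0" | "v (Suc d) = 0" | "v d \<noteq> 0" "v (Suc d) \<noteq> 0" by blast
    then show ?thesis
    proof cases
      case 1
      then show ?thesis using \<mu>(2) single[of _ "v (Suc d)"] by (auto simp: slope_fst_def slope_snd_def)
    next
      case 2
      then show ?thesis using \<mu>(3) single[of _ "v d"] by (auto simp: slope_fst_def slope_snd_def)
    next
      case 3
      have "\<forall>l<Suc (Suc d). v l = v d * g (Inr True) l + v (Suc d) * g (Inr False) l"
        using z unfolding g_def sum.case extend_combination by (simp add: slope_fst_def slope_snd_def)
      moreover have "\<beta>' (Inr True) \<noteq> \<beta>' (Inr False)" by (simp add: \<beta>'_def)
      moreover have "Inr True \<in> J" "Inr False \<in> J" "Inr True \<notin> U" "Inr False \<notin> U" by (auto simp: J_def U_def)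
      ultimately show ?thesis using 3 by blast
    qed
  qed
  ultimately have "sloped_cover (Suc (Suc d)) \<gamma> J g \<beta>' U" using UJ unfolding sloped_cover_def by blast
  moreover have "finite J" by (simp add: J_def)
  moreover have "card J = M * CARD('a) + 2"
  proof -
    have "card J = card (Inl ` ({..<M} \<times> (UNIV :: 'a set)) :: (nat \<times> 'a + bool) set) + card (range Inr :: (nat \<times> 'a + bool) set)"
      unfolding J_def by (intro card_Un_disjoint) auto
    then show ?thesis by (simp add: card_image card_cartesian_product)
  qed
  ultimately show ?thesis using \<sigma> by blast
qed

section \<open>Iterating the lift\<close>

definition two_cover :: "nat \<Rightarrow> nat \<Rightarrow> (nat \<Rightarrow> nat \<Rightarrow> 'a::field) \<Rightarrow> bool" where
  "two_cover d N g \<longleftrightarrow> (\<forall>v. (\<exists>l<d. v l \<noteq> 0) \<longrightarrow> (\<exists>i<N. \<exists>j<N. \<exists>a b. i \<noteq> j \<and> (\<forall>l<d. v l = a * g i l + b * g j l)))"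

text \<open>The first lift turns \<open>M\<close> columns into \<open>M * q + 2\<close>; each of the
  \<open>m\<close> further lifts multiplies their number by \<open>q\<close>.\<close>

theorem two_cover_tower:
  fixes h :: "nat \<Rightarrow> nat \<Rightarrow> 'a::{field,finite}"
  assumes M: "3 \<le> M" "2 * M \<le> CARD('a) + 1" and q: "CARD('a) \<ge> 5"
    and cover: "\<And>v. \<exists>l<d. v l \<noteq> 0 \<Longrightarrow>
      \<exists>i<M. \<exists>j<M. \<exists>a b. a \<noteq> 0 \<and> b \<noteq> 0 \<and> i \<noteq> j \<and> (\<forall>l<d. v l = a * h i l + b * h j l)"
  shows "\<exists>g :: nat \<Rightarrow> nat \<Rightarrow> 'a. two_cover (d + 2 * Suc m) ((M * CARD('a) + 2) * CARD('a) ^ m) g"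
proof -
  let ?q = "CARD('a)"
  obtain \<gamma> :: "'a option \<Rightarrow> nat" and \<sigma> J g0 \<beta>0 U0 where \<sigma>: "\<And>b. \<sigma> b \<noteq> b" "\<And>b. \<gamma> (\<sigma> b) = \<gamma> b" and J: "finite J" "card J = M * ?q + 2"
    and S0: "sloped_cover (Suc (Suc d)) \<gamma> (J :: (nat \<times> 'a + bool) set) g0 \<beta>0 U0"
    using sloped_cover_base[OF M q cover] by blast
  \<comment> \<open>A lift changes the index type; reindexing by initial segments of the naturals
    keeps it fixed during the induction.\<close>
  have "\<exists>(g :: nat \<Rightarrow> nat \<Rightarrow> 'a) \<beta> U. sloped_cover (d + 2 * Suc m) \<gamma> {..<(M * ?q + 2) * ?q ^ m} g \<beta> U"
  proof (induction m)
    case 0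
    obtain f where "bij_betw f {..<M * ?q + 2} J"
      using finite_same_card_bij[of "{..<M * ?q + 2}" J] J by auto
    from sloped_cover_reindex[OF S0 this] show ?case by auto
  next
    case (Suc m)
    let ?N = "(M * ?q + 2) * ?q ^ m"
    from Suc obtain g :: "nat \<Rightarrow> nat \<Rightarrow> 'a" and \<beta> U where "sloped_cover (d + 2 * Suc m) \<gamma> {..<?N} g \<beta> U" by blast
    from sloped_cover_step[OF this \<sigma>] q obtain \<beta>' U' where
      S: "sloped_cover (Suc (Suc (d + 2 * Suc m))) \<gamma> ({..<?N} \<times> UNIV) (\<lambda>(i, \<xi>). extend (d + 2 * Suc m) (g i) (\<beta> i) \<xi>) \<beta>' U'"
      by auto
    have "card {..<?N * ?q} = card ({..<?N} \<times> (UNIV :: 'a set))" by (simp add: card_cartesian_product)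
    then obtain f where "bij_betw f {..<?N * ?q} ({..<?N} \<times> (UNIV :: 'a set))"
      using finite_same_card_bij[of "{..<?N * ?q}" "{..<?N} \<times> (UNIV :: 'a set)"] by auto
    from sloped_cover_reindex[OF S this]
    have "\<exists>(g :: nat \<Rightarrow> nat \<Rightarrow> 'a) \<beta> U. sloped_cover (Suc (Suc (d + 2 * Suc m))) \<gamma> {..<?N * ?q} g \<beta> U" by blast
    moreover have "Suc (Suc (d + 2 * Suc m)) = d + 2 * Suc (Suc m)" by simp
    moreover have "?N * ?q = (M * ?q + 2) * ?q ^ Suc m" by (simp only: power_Suc ac_simps)
    ultimately show ?case by metis
  qed
  then obtain g :: "nat \<Rightarrow> nat \<Rightarrow> 'a" and \<beta> U where S: "sloped_cover (d + 2 * Suc m) \<gamma> {..<(M * ?q + 2) * ?q ^ m} g \<beta> U" by blast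
  have "two_cover (d + 2 * Suc m) ((M * ?q + 2) * ?q ^ m) g"
    using S unfolding sloped_cover_def two_cover_def by (metis lessThan_iff)
  then show ?thesis by blast
qed

section \<open>Direct sums\<close>

text \<open>Surjectivity gives rank \<open>r\<close>; the dimension of the kernel follows by
  rank-nullity.\<close>

lemma linear_code_mat_kernel:
  fixes H :: "'a::{field,finite} mat"
  assumes H: "H \<in> carrier_mat r n" and surj: "\<And>v. v \<in> carrier_vec r \<Longrightarrow> \<exists>x\<in>carrier_vec n. H *\<^sub>v x = v"
  shows "linear_code n r (mat_kernel H)"
proof -
  interpret V: vec_space "TYPE('a)" n .
  interpret W: vec_space "TYPE('a)" r .
  interpret L: linear_map "class_ring :: 'a ring" "module_vec TYPE('a) n" "module_vec TYPE('a) r" "(*\<^sub>v) H"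
  proof -
    have "(*\<^sub>v) H \<in> LinearCombinations.module_hom class_ring (module_vec TYPE('a) n) (module_vec TYPE('a) r)"
      unfolding LinearCombinations.module_hom_def
      using H by (auto simp: mult_add_distrib_mat_vec[OF H] mult_mat_vec[OF H] matrix_vs_simps module_vec_simps)
    then show "linear_map class_ring (module_vec TYPE('a) n) (module_vec TYPE('a) r) ((*\<^sub>v) H)"
      unfolding linear_map_def mod_hom_def mod_hom_axioms_def
      using V.vectorspace_axioms W.vectorspace_axioms V.module_axioms W.module_axioms by blast
  qed
  have ker: "L.kerT = mat_kernel H"
    unfolding L.ker_def using H by (auto simp: mat_kernel[OF H] module_vec_simps)
  have im: "L.imT = carrier_vec r"
    unfolding L.im_def using H surj by (force simp: module_vec_simps)
  have "vectorspace.dim class_ring ((module_vec TYPE('a) r)\<lparr>carrier := carrier_vec r\<rparr>) = r"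
    using W.dim_is_n by (simp add: module_vec_def)
  then have "vectorspace.dim class_ring ((module_vec TYPE('a) n)\<lparr>carrier := mat_kernel H\<rparr>) + r = n"
    using L.rank_nullity[OF V.fin_dim] V.dim_is_n unfolding ker im by simp
  moreover have "VectorSpace.subspace class_ring (mat_kernel H) (module_vec TYPE('a) n)"
    using L.kerT_is_subspace unfolding ker .
  ultimately show ?thesis unfolding linear_code_def by blast
qed

text \<open>There are at most \<open>N * q\<close> multiples of columns against \<open>q ^ d\<close>
  vectors. A vector that is no such multiple needs at least two columns, which will bound the
  covering radius from below.\<close>

lemma exists_non_multiple:
  fixes g :: "nat \<Rightarrow> nat \<Rightarrow> 'a::{field,finite}"
  assumes small: "N * CARD('a) < CARD('a) ^ d"
  shows "\<exists>w. \<forall>i<N. \<forall>c. \<exists>l<d. w l \<noteq> c * g i l"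
proof (rule ccontr)
  assume no: "\<not> ?thesis"
  let ?f = "\<lambda>(i, c). restrict (\<lambda>l. c * g i l) {..<d}"
  have "({..<d} \<rightarrow>\<^sub>E (UNIV :: 'a set)) \<subseteq> ?f ` ({..<N} \<times> UNIV)"
  proof
    fix w assume w: "w \<in> {..<d} \<rightarrow>\<^sub>E (UNIV :: 'a set)"
    obtain i c where ic: "i < N" "\<And>l. l < d \<Longrightarrow> w l = c * g i l" using no by blast
    have "w = ?f (i, c)"
    proof
      fix l
      show "w l = ?f (i, c) l"
        using ic(2)[of l] PiE_arb[OF w, of l] by (cases "l < d") simp_all
    qed
    then show "w \<in> ?f ` ({..<N} \<times> UNIV)" using ic by blast
  qed
  then have "card ({..<d} \<rightarrow>\<^sub>E (UNIV :: 'a set)) \<le> card ({..<N} \<times> (UNIV :: 'a set))"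
    by (intro surj_card_le) auto
  then show False using small by (simp add: card_PiE card_cartesian_product)
qed

text \<open>Block diagonal matrix with \<open>u\<close> copies of the matrix whose columns are
  \<open>g 0, ..., g (N - 1)\<close>, followed by zero columns.\<close>

definition block_matrix :: "nat \<Rightarrow> nat \<Rightarrow> nat \<Rightarrow> (nat \<Rightarrow> nat \<Rightarrow> 'a::zero) \<Rightarrow> nat \<Rightarrow> 'a mat" where
  "block_matrix u d N g n = mat (u * d) n
     (\<lambda>(r, c). if c < u * N \<and> c div N = r div d then g (c mod N) (r mod d) else 0)"

lemma block_index_less: "k < u \<Longrightarrow> i < N \<Longrightarrow> k * N + i < u * (N::nat)"
proof -
  assume "k < u" "i < N"
  then have "k * N + i < Suc k * N" by simp
  also have "\<dots> \<le> u * N" using \<open>k < u\<close> by (intro mult_le_mono1) simp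
  finally show ?thesis .
qed

lemma block_matrix_mult:
  fixes x :: "'a::field vec"
  assumes n: "u * N \<le> n" and x: "x \<in> carrier_vec n" and k: "k < u" and l: "l < d"
  shows "(block_matrix u d N g n *\<^sub>v x) $ (k * d + l) = (\<Sum>i<N. x $ (k * N + i) * g i l)"
proof -
  have r: "k * d + l < u * d" by (rule block_index_less[OF k l])
  have rd: "(k * d + l) div d = k" "(k * d + l) mod d = l" using l by simp_all
  have "(block_matrix u d N g n *\<^sub>v x) $ (k * d + l) =
      (\<Sum>c = 0..<n. (if c < u * N \<and> c div N = k then g (c mod N) l else 0) * x $ c)"
    using r x l by (simp add: block_matrix_def scalar_prod_def rd cong: if_cong)
  also have "\<dots> = (\<Sum>c \<in> (\<lambda>i. k * N + i) ` {..<N}. g (c mod N) l * x $ c)"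
  proof (rule sum.mono_neutral_cong_right)
    show "(\<lambda>i. k * N + i) ` {..<N} \<subseteq> {0..<n}" using block_index_less[OF k, of _ N] n by force
    show "\<forall>c\<in>{0..<n} - (\<lambda>i. k * N + i) ` {..<N}. (if c < u * N \<and> c div N = k then g (c mod N) l else 0) * x $ c = 0"
    proof
      fix c assume c: "c \<in> {0..<n} - (\<lambda>i. k * N + i) ` {..<N}"
      have "\<not> (c < u * N \<and> c div N = k)"
      proof
        assume a: "c < u * N \<and> c div N = k"
        then have "N > 0" by (cases N) auto
        then have "c = k * N + c mod N" "c mod N < N" using a by auto
        then show False using c by blast
      qed
      then show "(if c < u * N \<and> c div N = k then g (c mod N) l else 0) * x $ c = 0" by auto
    qed
    show "(if c < u * N \<and> c div N = k then g (c mod N) l else 0) * x $ c = g (c mod N) l * x $ c"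
      if "c \<in> (\<lambda>i. k * N + i) ` {..<N}" for c
      using that block_index_less[OF k] by auto
  qed auto
  also have "\<dots> = (\<Sum>i<N. g i l * x $ (k * N + i))"
    by (subst sum.reindex) (auto simp: inj_on_def)
  finally show ?thesis by (simp add: mult.commute)
qed

text \<open>Uniqueness of quotient and remainder by \<open>N\<close>. The predicate selects a
  support in each block, so that supports can be counted block by block.\<close>

lemma block_inj: "inj_on (\<lambda>(k, i). k * N + i) (SIGMA k:{..<u}. {i. i < N \<and> P k (i::nat)})"
proof (rule inj_onI)
  fix a b assume a: "a \<in> (SIGMA k:{..<u}. {i. i < N \<and> P k i})" and b: "b \<in> (SIGMA k:{..<u}. {i. i < N \<and> P k i})"
    and eq: "(\<lambda>(k, i). k * N + i) a = (\<lambda>(k, i). k * N + i) b"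
  obtain k i k' i' where [simp]: "a = (k, i)" "b = (k', i')" by force
  have i: "i < N" "i' < N" using a b by auto
  have e: "k * N + i = k' * N + i'" using eq by simp
  have "k = (k * N + i) div N" "k' = (k' * N + i') div N" using i by simp_all
  moreover have "i = (k * N + i) mod N" "i' = (k' * N + i') mod N" using i by simp_all
  ultimately show "a = b" using e by simp
qed

lemma two_cover_coefficients:
  fixes g :: "nat \<Rightarrow> nat \<Rightarrow> 'a::field"
  assumes "two_cover d N g"
  shows "\<exists>y. card {i. i < N \<and> y i \<noteq> 0} \<le> 2 \<and> (\<forall>l<d. w l = (\<Sum>i<N. y i * g i l))"
proof (cases "\<exists>l<d. w l \<noteq> 0")
  case True
  then obtain i j a b where ij: "i < N" "j < N" "i \<noteq> j" "\<forall>l<d. w l = a * g i l + b * g j l"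
    using assms unfolding two_cover_def by blast
  define y where "y = (\<lambda>m. if m = i then a else if m = j then b else 0)"
  have "card {m. m < N \<and> y m \<noteq> 0} \<le> card {i, j}" by (intro card_mono) (auto simp: y_def)
  moreover have "(\<Sum>m<N. y m * g m l) = a * g i l + b * g j l" for l
  proof -
    have "(\<Sum>m<N. y m * g m l) = (\<Sum>m\<in>{i, j}. y m * g m l)"
      using ij by (intro sum.mono_neutral_right) (auto simp: y_def)
    then show ?thesis using ij by (simp add: y_def)
  qed
  ultimately show ?thesis using ij by (intro exI[of _ y]) simp
next
  case False
  then show ?thesis by (intro exI[of _ "\<lambda>_. 0"]) auto
qed

(* The columns from u * N on are zero and only pad the length. *)
lemma direct_sum_covering_code:
  fixes g :: "nat \<Rightarrow> nat \<Rightarrow> 'a::{field,finite}"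
  assumes cover: "two_cover d N g" and small: "N * CARD('a) < CARD('a) ^ d" and n: "u * N \<le> n" and N: "N > 0"
  shows "\<exists>C :: 'a vec set. covering_code n (u * d) (2 * u) C"
proof -
  define H where "H = block_matrix u d N g n"
  have H: "H \<in> carrier_mat (u * d) n" by (simp add: H_def block_matrix_def)
  have dpos: "d > 0" using small N by (cases d) auto
  have split: "\<exists>k<u. \<exists>l<d. r = k * d + l" if "r < u * d" for r
    using that dpos by (intro exI[of _ "r div d"] conjI exI[of _ "r mod d"]) (auto simp: less_mult_imp_div_less)
  have mult: "(H *\<^sub>v x) $ (k * d + l) = (\<Sum>i<N. x $ (k * N + i) * g i l)"
    if "x \<in> carrier_vec n" "k < u" "l < d" for x k l
    unfolding H_def by (rule block_matrix_mult[OF n that])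
  have cov: "columns_cover H (2 * u)"
    unfolding columns_cover_def
  proof
    fix v :: "'a vec" assume "v \<in> carrier_vec (dim_row H)"
    then have v: "v \<in> carrier_vec (u * d)" using H by auto
    \<comment> \<open>The blocks of \<open>v\<close> are treated separately, with at most two
      columns for each.\<close>
    have "\<forall>k. \<exists>y. card {i. i < N \<and> y i \<noteq> 0} \<le> 2 \<and> (\<forall>l<d. v $ (k * d + l) = (\<Sum>i<N. y i * g i l))"
      by (intro allI two_cover_coefficients[OF cover])
    then obtain y where "\<forall>k. card {i. i < N \<and> y k i \<noteq> 0} \<le> 2 \<and> (\<forall>l<d. v $ (k * d + l) = (\<Sum>i<N. y k i * g i l))"
      by (rule exE[OF choice])
    then have y: "\<And>k. card {i. i < N \<and> y k i \<noteq> 0} \<le> 2"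
      "\<And>k l. l < d \<Longrightarrow> v $ (k * d + l) = (\<Sum>i<N. y k i * g i l)" by simp_all
    define x where "x = vec n (\<lambda>c. if c < u * N then y (c div N) (c mod N) else 0)"
    have x: "x \<in> carrier_vec n" by (simp add: x_def)
    have xk: "x $ (k * N + i) = y k i" if "k < u" "i < N" for k i
      using block_index_less[OF that] n that by (simp add: x_def)
    have Hx: "H *\<^sub>v x = v"
    proof (rule eq_vecI)
      fix r assume "r < dim_vec v"
      then have "r < u * d" using v by simp
      from split[OF this] obtain k l where kl: "k < u" "l < d" "r = k * d + l" by blast
      then show "(H *\<^sub>v x) $ r = v $ r" using mult[OF x kl(1,2)] y(2)[OF kl(2)] xk[OF kl(1)] by simp
    qed (use H v in auto)
    have "{c. c < dim_col H \<and> x $ c \<noteq> 0} \<subseteq> (\<lambda>(k, i). k * N + i) ` (SIGMA k:{..<u}. {i. i < N \<and> y k i \<noteq> 0})"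
    proof
      fix c assume "c \<in> {c. c < dim_col H \<and> x $ c \<noteq> 0}"
      then have "c < u * N" "y (c div N) (c mod N) \<noteq> 0" using H by (auto simp: x_def split: if_splits)
      then show "c \<in> (\<lambda>(k, i). k * N + i) ` (SIGMA k:{..<u}. {i. i < N \<and> y k i \<noteq> 0})"
        using N by (intro image_eqI[of _ _ "(c div N, c mod N)"]) (auto simp: less_mult_imp_div_less)
    qed
    then have "card {c. c < dim_col H \<and> x $ c \<noteq> 0} \<le> card (SIGMA k:{..<u}. {i. i < N \<and> y k i \<noteq> 0})"
      by (intro surj_card_le) auto
    then have "card {c. c < dim_col H \<and> x $ c \<noteq> 0} \<le> (\<Sum>k<u. card {i. i < N \<and> y k i \<noteq> 0})"
      by (simp add: card_SigmaI)
    also have "\<dots> \<le> (\<Sum>k<u. 2)" by (intro sum_mono y(1))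
    finally have "card {c. c < dim_col H \<and> x $ c \<noteq> 0} \<le> 2 * u" by simp
    then show "\<exists>x\<in>carrier_vec (dim_col H). card {i. i < dim_col H \<and> x $ i \<noteq> 0} \<le> 2 * u \<and> H *\<^sub>v x = v"
      using x H Hx by auto
  qed
  have "\<not> columns_cover H \<rho>" if \<rho>: "\<rho> < 2 * u" for \<rho>
  proof
    assume c: "columns_cover H \<rho>"
    \<comment> \<open>All blocks of the test vector equal a \<open>w\<close> that is no multiple of
      a column, so each of the \<open>u\<close> blocks uses at least two columns.\<close>
    obtain w where w: "\<And>i c. i < N \<Longrightarrow> \<exists>l<d. w l \<noteq> c * g i l"
      using exists_non_multiple[OF small, of g] by blast
    define v where "v = vec (u * d) (\<lambda>r. w (r mod d))"
    obtain x where x: "x \<in> carrier_vec n" and cx: "card {i. i < n \<and> x $ i \<noteq> 0} \<le> \<rho>" and Hx: "H *\<^sub>v x = v"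
      using c H unfolding columns_cover_def v_def by force
    have two: "card {i. i < N \<and> x $ (k * N + i) \<noteq> 0} \<ge> 2" if k: "k < u" for k
    proof (rule ccontr)
      let ?S = "{i. i < N \<and> x $ (k * N + i) \<noteq> 0}"
      assume "\<not> 2 \<le> card ?S"
      then have "card ?S \<le> 1" by simp
      then have eq: "\<And>i j. i \<in> ?S \<Longrightarrow> j \<in> ?S \<Longrightarrow> i = j" using card_le_Suc0_iff_eq[of ?S] by simp
      \<comment> \<open>With empty support \<open>w\<close> would be 0 times some column;
        \<open>N > 0\<close> supplies one.\<close>
      obtain i where i: "i < N" "?S \<subseteq> {i}"
      proof (cases "?S = {}")
        case True
        then show ?thesis using that[OF N] by blast
      next
        case False
        then obtain i where "i \<in> ?S" by blast
        then show ?thesis using that[of i] eq by blast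
      qed
      have "w l = x $ (k * N + i) * g i l" if l: "l < d" for l
      proof -
        have "w l = (H *\<^sub>v x) $ (k * d + l)" using block_index_less[OF k l] l by (simp add: Hx v_def)
        also have "\<dots> = (\<Sum>j<N. x $ (k * N + j) * g j l)" by (rule mult[OF x k l])
        also have "\<dots> = (\<Sum>j\<in>{i}. x $ (k * N + j) * g j l)"
          using i by (intro sum.mono_neutral_right) auto
        finally show ?thesis by simp
      qed
      then show False using w[OF i(1)] by blast
    qed
    have "2 * u = (\<Sum>k<u. 2)" by simp
    also have "\<dots> \<le> (\<Sum>k<u. card {i. i < N \<and> x $ (k * N + i) \<noteq> 0})" using two by (intro sum_mono) auto
    also have "\<dots> = card (SIGMA k:{..<u}. {i. i < N \<and> x $ (k * N + i) \<noteq> 0})" by (simp add: card_SigmaI)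
    also have "\<dots> \<le> card {i. i < n \<and> x $ i \<noteq> 0}"
    proof (rule card_inj_on_le[OF block_inj])
      show "(\<lambda>(k, i). k * N + i) ` (SIGMA k:{..<u}. {i. i < N \<and> x $ (k * N + i) \<noteq> 0}) \<subseteq> {i. i < n \<and> x $ i \<noteq> 0}"
        using block_index_less[of _ u _ N] n by force
    qed simp
    finally show False using cx \<rho> by linarith
  qed
  then have "has_covering_radius H (2 * u)" using cov unfolding has_covering_radius_def by blast
  moreover have "linear_code n (u * d) (mat_kernel H)"
    using cov H unfolding columns_cover_def by (intro linear_code_mat_kernel) auto
  ultimately show ?thesis unfolding covering_code_def parity_check_matrix_def using H by blast
qed

section \<open>Lengths\<close>

lemma minus_1_dvd_power_minus_1: "x - 1 dvd x ^ n - (1 :: nat)"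
proof (cases "x = 0")
  case False
  show ?thesis
  proof (induction n)
    case (Suc n)
    have "x ^ Suc n - 1 = x ^ n * (x - 1) + (x ^ n - 1)"
      using False by (simp add: diff_mult_distrib2 mult.commute)
    then show ?case using Suc by simp
  qed simp
qed (cases n; simp)

section \<open>The order of the largest proper subfield\<close>

lemma ring_class_ring: "ring (class_ring :: 'a::field ring)"
  using class_field unfolding field_def domain_def cring_def by blast

lemma (in subfield_set) subfield_class_ring: "subfield k (class_ring :: 'a ring)"
proof -
  have "subring k (class_ring :: 'a ring)"
    using closed by (intro ring.subringI[OF ring_class_ring]) (auto simp: class_ring_simps)
  then show ?thesis
    using inverse_mem by (intro field.subfieldI'[OF class_field]) (auto simp: class_ring_simps)
qed

text \<open>\<open>phi\<close> ranges over fields whose carrier consists of naturals; the pair of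
  fields is transported there along an injection.\<close>

lemma (in subfield_pair) proper_subfield_nat:
  assumes "k \<noteq> K"
  shows "\<exists>k' (F :: nat ring). field F \<and> card (carrier F) = card K \<and> subfield k' F \<and> k' \<noteq> carrier F"
proof -
  let ?R = "(class_ring :: 'a ring)\<lparr>carrier := K\<rparr>"
  have "field ?R" using ring.subfield_iff(2)[OF ring_class_ring K.subfield_class_ring] .
  then interpret R: field ?R .
  have "field ((class_ring :: 'a ring)\<lparr>carrier := k\<rparr>)" using ring.subfield_iff(2)[OF ring_class_ring k.subfield_class_ring] .
  then have sk: "subfield k ?R" using sub by (intro R.subfield_iff(1)) auto
  obtain f :: "'a \<Rightarrow> nat" where f: "inj f" using finite_imp_inj_to_nat_seg[of "UNIV :: 'a set"] by auto
  have fi: "inj_on f (carrier ?R)" using f by (auto intro: inj_on_subset)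
  let ?F = "image_ring f ?R"
  have F: "field ?F" by (rule R.inj_imp_image_ring_is_field[OF fi])
  then interpret F: field ?F .
  have "f \<in> Ring.ring_hom ?R ?F" using inj_imp_image_ring_iso[OF fi] by (simp add: ring_iso_def)
  then interpret h: ring_hom_ring ?R ?F f by (intro ring_hom_ringI2 R.ring_axioms F.ring_axioms)
  have "subfield (f ` k) ?F" by (rule h.img_is_subfield(2)[OF sk F.one_not_zero])
  moreover have cF: "carrier ?F = f ` K" by (simp add: image_ring_carrier)
  moreover have "card (f ` K) = card K" using f by (intro card_image) (auto intro: inj_on_subset)
  moreover have "f ` k \<noteq> f ` K" using assms f by (simp add: inj_image_eq_iff)
  ultimately show ?thesis using F by metis
qed

text \<open>The set under \<open>Max\<close> is finite, and nonempty because the subfield of order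
  \<open>p ^ h\<close> of \<open>'a\<close> properly contains the one of order \<open>p\<close>. The
  maximum is thus the order of an actual proper subfield, and Lagrange's theorem gives the
  divisibilities.\<close>

lemma phi_subfield:
  fixes p h :: nat
  assumes p: "Factorial_Ring.prime p" and h: "h \<ge> 2" and q: "CARD('a::{field,finite}) = p ^ (2 * h)"
  shows "1 < phi (p ^ h)" and "phi (p ^ h) < p ^ h" and "phi (p ^ h) dvd p ^ h" and "phi (p ^ h) - 1 dvd p ^ h - 1"
proof -
  let ?s = "p ^ h"
  let ?S = "{card K | K (F :: nat ring). field F \<and> card (carrier F) = ?s \<and> subfield K F \<and> K \<noteq> carrier F}"
  have p1: "p > 1" using prime_gt_1_nat[OF p] .
  have s0: "?s > 0" using p1 by simp
  have ps: "p < ?s" using p1 h power_strict_increasing[of 1 h p] by simp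
  have CH: "CHAR('a) = p" by (rule CHAR_of_card_prime_power[OF p q])
  have finF: "finite (carrier F)" if "card (carrier F) = ?s" for F :: "nat ring"
    using that s0 card_gt_0_iff by metis
  have sd: "?s - 1 dvd CARD('a) - 1"
    unfolding q power_mult mult.commute[of 2 h] by (rule minus_1_dvd_power_minus_1)
  have pd: "p - 1 dvd ?s - 1" by (rule minus_1_dvd_power_minus_1)
  interpret pair: subfield_pair "power_fixed p :: 'a set" "power_fixed ?s :: 'a set"
    using subfield_power_fixed[OF CH, of p 1] subfield_power_fixed[OF CH, of ?s h] power_fixed_subset[OF pd s0 p1]
    by (simp add: subfield_pair_def subfield_pair_axioms_def)
  have cards: "card (power_fixed p :: 'a set) = p" "card (power_fixed ?s :: 'a set) = ?s"
    using card_power_fixed[OF dvd_trans[OF pd sd] p1] card_power_fixed[OF sd] p1 ps by linarith+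
  have "(power_fixed p :: 'a set) \<noteq> power_fixed ?s"
  proof
    assume "(power_fixed p :: 'a set) = power_fixed ?s"
    from arg_cong[OF this, of card] show False using cards ps by simp
  qed
  from pair.proper_subfield_nat[OF this] have "?S \<noteq> {}" unfolding cards by blast
  moreover have "?S \<subseteq> {..?s}"
  proof
    fix n assume "n \<in> ?S"
    then obtain K and F :: "nat ring" where *: "n = card K" "card (carrier F) = ?s" "subfield K F" by blast
    show "n \<in> {..?s}" using card_mono[OF finF[OF *(2)] subfieldE(3)[OF *(3)]] * by simp
  qed
  then have "finite ?S" using finite_subset by blast
  ultimately have "phi ?s \<in> ?S" unfolding phi_def by (intro Max_in)
  then obtain K and F :: "nat ring" where F: "field F" "card (carrier F) = ?s" and K: "subfield K F" "K \<noteq> carrier F"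
    and phi: "phi ?s = card K" by blast
  show "phi ?s dvd ?s" "phi ?s - 1 dvd ?s - 1" using subfield_card[OF F(1) finF[OF F(2)] K(1)] F(2) phi by simp_all
  have KF: "K \<subset> carrier F" using K subfieldE(3) by blast
  then show "phi ?s < ?s" using psubset_card_mono[OF finF[OF F(2)]] unfolding phi F(2) by blast
  have "\<zero>\<^bsub>F\<^esub> \<in> K" "\<one>\<^bsub>F\<^esub> \<in> K" using subringE(2,3)[OF subfieldE(1)[OF K(1)]] by auto
  moreover have "\<one>\<^bsub>F\<^esub> \<noteq> \<zero>\<^bsub>F\<^esub>" using subfieldE(6)[OF K(1)] .
  ultimately have "card {\<zero>\<^bsub>F\<^esub>, \<one>\<^bsub>F\<^esub>} \<le> card K"
    using finF[OF F(2)] KF by (intro card_mono) (auto intro: finite_subset)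
  then show "1 < phi ?s" using \<open>\<one>\<^bsub>F\<^esub> \<noteq> \<zero>\<^bsub>F\<^esub>\<close> phi by auto
qed

text \<open>Compares the size bound \<open>s + m + 1\<close> of a blocking set with the term
  \<open>s + (s - 1) / (\<kappa> - 1)\<close> of the first length. As
  \<open>s - 1 = (\<kappa> - 1) * m + (m - 1)\<close>, the number \<open>\<kappa> - 1\<close>
  divides \<open>m - 1\<close>, and the quotient is \<open>m + c\<close> with
  \<open>c \<ge> 1\<close>.\<close>

lemma subfield_order_sqrt:
  fixes \<kappa> s m :: nat
  assumes "1 < \<kappa>" and "\<kappa> < s" and s: "s = \<kappa> * m" and d: "\<kappa> - 1 dvd s - 1"
  shows "\<kappa> \<le> m" and "s + m + 1 \<le> s + (s - 1) div (\<kappa> - 1)"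
proof -
  have m1: "m > 1" using assms by (cases m) auto
  have e: "s - 1 = (\<kappa> - 1) * m + (m - 1)"
    using s assms(1) m1 by (cases \<kappa>; cases m) auto
  then have "\<kappa> - 1 dvd m - 1" using d by (metis dvd_add_right_iff dvd_triv_left)
  then obtain c where c: "m - 1 = (\<kappa> - 1) * c" by auto
  then have "c \<ge> 1" using m1 by (cases c) auto
  then have "\<kappa> - 1 \<le> m - 1" unfolding c by simp
  then show "\<kappa> \<le> m" using m1 by linarith
  have "s - 1 = (\<kappa> - 1) * (m + c)" using e c by (simp add: distrib_left)
  then have "(s - 1) div (\<kappa> - 1) = m + c" using assms(1) by simp
  then show "s + m + 1 \<le> s + (s - 1) div (\<kappa> - 1)" using \<open>c \<ge> 1\<close> by simp
qed

text \<open>For \<open>t = 1\<close> the saturating set is used as it is; for larger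
  \<open>t\<close> it is lifted \<open>t - 1\<close> times. Then \<open>u\<close> copies are added,
  and zero columns fill up to \<open>n\<close>.\<close>

lemma covering_code_exists:
  fixes p h \<kappa> m t u n :: nat
  assumes p: "Factorial_Ring.prime p" and q: "CARD('a::{field,finite}) = p ^ (2 * h)"
    and \<kappa>: "3 \<le> \<kappa>" "\<kappa> < p ^ h" "p ^ h = \<kappa> * m" "\<kappa> - 1 dvd p ^ h - 1" and t: "t \<ge> 1"
    and n: "u * (2 * (p ^ h + m + 1) * CARD('a) ^ (t - 1) + (if t \<ge> 2 then 2 * CARD('a) ^ (t - 2) else 0)) \<le> n"
  shows "\<exists>C :: 'a vec set. covering_code n (u * (2 * t + 1)) (2 * u) C"
proof -
  let ?s = "p ^ h" and ?q = "CARD('a)"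
  have qs: "?q = ?s ^ 2" unfolding q by (simp add: power_mult mult.commute)
  have CH: "CHAR('a) = p" by (rule CHAR_of_card_prime_power[OF p q])
  have sd: "?s - 1 dvd ?q - 1"
    unfolding q power_mult mult.commute[of 2 h] by (rule minus_1_dvd_power_minus_1)
  obtain e where e: "\<kappa> = p ^ e" using \<kappa>(3) divides_primepow_nat[OF p] by (metis dvd_triv_left)
  interpret pair: subfield_pair "power_fixed \<kappa> :: 'a set" "power_fixed ?s :: 'a set"
    using subfield_power_fixed[OF CH e] subfield_power_fixed[OF CH, of ?s h] power_fixed_subset[OF \<kappa>(4)] \<kappa>
    by (simp add: subfield_pair_def subfield_pair_axioms_def)
  have cards: "card (power_fixed \<kappa> :: 'a set) = \<kappa>" "card (power_fixed ?s :: 'a set) = ?s"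
    using card_power_fixed[OF dvd_trans[OF \<kappa>(4) sd]] card_power_fixed[OF sd] \<kappa>(1,2) by linarith+
  have ne: "(power_fixed \<kappa> :: 'a set) \<noteq> power_fixed ?s"
  proof
    assume "(power_fixed \<kappa> :: 'a set) = power_fixed ?s"
    from arg_cong[OF this, of card] show False using cards \<kappa>(2) by simp
  qed
  have \<kappa>m: "\<kappa> \<le> m" using subfield_order_sqrt(1)[of \<kappa> ?s m] \<kappa> by simp
  have div: "?s div \<kappa> = m" using \<kappa> by simp
  obtain B :: "('a \<times> 'a \<times> 'a) set" where B: "3 \<le> card B" "card B \<le> 2 * (?s + m + 1)"
    and rep: "\<And>x y z. (x, y, z) \<noteq> (0, 0, 0) \<Longrightarrow> \<exists>p\<in>B. \<exists>p'\<in>B. \<exists>c c'. p \<noteq> p' \<and> c \<noteq> 0 \<and> c' \<noteq> 0 \<and>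
      x = c * fst p + c' * fst p' \<and> y = c * fst (snd p) + c' * fst (snd p') \<and> z = c * snd (snd p) + c' * snd (snd p')"
    using pair.saturating_set[unfolded cards div, OF \<kappa>(1) ne qs] by blast
  define M where "M = card B"
  obtain b where b: "bij_betw b {..<M} B"
    using finite_same_card_bij[of "{..<M}" B] by (auto simp: M_def)
  define g :: "nat \<Rightarrow> nat \<Rightarrow> 'a" where
    "g i = (\<lambda>l. if l = 0 then fst (b i) else if l = 1 then fst (snd (b i)) else snd (snd (b i)))" for i
  have l3: "(\<forall>l<3. P l) \<longleftrightarrow> P 0 \<and> P 1 \<and> P 2" for P :: "nat \<Rightarrow> bool"
    by (auto simp: less_Suc_eq numeral_3_eq_3 numeral_2_eq_2)
  have cover: "\<exists>i<M. \<exists>j<M. \<exists>a c. a \<noteq> 0 \<and> c \<noteq> 0 \<and> i \<noteq> j \<and> (\<forall>l<3. v l = a * g i l + c * g j l)"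
    if "\<exists>l<3. v l \<noteq> 0" for v
  proof -
    have "\<not> (\<forall>l<3. v l = 0)" using that by blast
    then have "(v 0, v 1, v 2) \<noteq> (0, 0, 0)" unfolding l3 by simp
    from rep[OF this] obtain x x' a c where x: "x \<in> B" "x' \<in> B" "x \<noteq> x'" "a \<noteq> 0" "c \<noteq> 0"
      "v 0 = a * fst x + c * fst x'" "v 1 = a * fst (snd x) + c * fst (snd x')" "v 2 = a * snd (snd x) + c * snd (snd x')"
      by blast
    obtain i j where ij: "i < M" "j < M" "x = b i" "x' = b j"
      using x(1,2) b unfolding bij_betw_def by (metis imageE lessThan_iff)
    have "\<forall>l<3. v l = a * g i l + c * g j l" unfolding l3 using x ij by (simp add: g_def)
    moreover have "i \<noteq> j" using x ij by auto
    ultimately show ?thesis using ij x by blast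
  qed
  \<comment> \<open>These estimates give the condition \<open>2 * M \<le> ?q + 1\<close> of the
    colouring: \<open>2 * M\<close> is at most \<open>4 * ?s + 4 * m + 4\<close>, while
    \<open>?q \<ge> 9 * ?s\<close>, \<open>3 * m \<le> ?s\<close> and
    \<open>?s \<ge> 9\<close>.\<close>
  have s3: "3 * m \<le> ?s" unfolding \<kappa>(3) using \<kappa>(1) by simp
  have "3 * 3 \<le> \<kappa> * m" using \<kappa> \<kappa>m by (intro mult_le_mono) auto
  then have s9: "9 \<le> ?s" unfolding \<kappa>(3) by simp
  then have "9 * ?s \<le> ?q" unfolding qs power2_eq_square by (rule mult_le_mono1)
  then have q5: "5 \<le> ?q" using s9 by linarith
  have "M \<le> 2 * ?s + 2 * m + 2" using B(2) by (simp add: M_def)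
  then have M2: "2 * M \<le> ?q + 1" using \<open>9 * ?s \<le> ?q\<close> s3 s9 by linarith
  have M3: "3 \<le> M" using B by (simp add: M_def)
  obtain N g' where N: "two_cover (2 * t + 1) N (g' :: nat \<Rightarrow> nat \<Rightarrow> 'a)" "N > 0" "N * ?q < ?q ^ (2 * t + 1)"
    "N \<le> 2 * (?s + m + 1) * ?q ^ (t - 1) + (if t \<ge> 2 then 2 * ?q ^ (t - 2) else 0)"
  proof (cases "t = 1")
    case True
    have "two_cover 3 M g" unfolding two_cover_def using cover by blast
    moreover have "M * ?q < ?q ^ 3"
    proof -
      have "M * ?q < (?q * ?q) * ?q" using M2 q5 by (intro mult_strict_right_mono) (auto intro: less_le_trans[of M ?q])
      then show ?thesis by (simp add: power3_eq_cube)
    qed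
    ultimately show ?thesis using that[of M g] True B M3 by (simp add: M_def numeral_3_eq_3)
  next
    case False
    then obtain j where j: "t = j + 2" using t by (metis One_nat_def Suc_1 add.commute le_Suc_ex le_neq_implies_less not_less_eq_eq not_less)
    obtain g' :: "nat \<Rightarrow> nat \<Rightarrow> 'a" where g': "two_cover (3 + 2 * Suc j) ((M * ?q + 2) * ?q ^ j) g'"
      using two_cover_tower[OF M3 M2 q5 cover] by blast
    have "(M * ?q + 2) * ?q ^ j * ?q < ?q ^ (2 * t + 1)"
    proof -
      have "M * ?q + 2 < ?q * ?q * ?q"
      proof -
        have "(M + 1) * ?q \<le> (?q * ?q) * ?q"
        proof (rule mult_le_mono1)
          have "M + 1 \<le> ?q" using M2 q5 by linarith
          also have "\<dots> \<le> ?q * ?q" by simp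
          finally show "M + 1 \<le> ?q * ?q" .
        qed
        then show ?thesis using q5 by (simp add: algebra_simps)
      qed
      then have "(M * ?q + 2) * ?q ^ (j + 1) < ?q ^ 3 * ?q ^ (j + 1)"
        using q5 by (intro mult_strict_right_mono) (auto simp: power3_eq_cube)
      also have "\<dots> = ?q ^ (j + 4)" by (simp add: power_add power_numeral_reduce)
      also have "\<dots> \<le> ?q ^ (2 * t + 1)" using q5 j by (intro power_increasing) auto
      finally show ?thesis by (simp add: ac_simps)
    qed
    moreover have "(M * ?q + 2) * ?q ^ j \<le> 2 * (?s + m + 1) * ?q ^ (j + 1) + 2 * ?q ^ j"
    proof -
      have "(M * ?q + 2) * ?q ^ j = M * ?q ^ (j + 1) + 2 * ?q ^ j" by (simp add: algebra_simps)
      also have "\<dots> \<le> 2 * (?s + m + 1) * ?q ^ (j + 1) + 2 * ?q ^ j"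
        using B(2) unfolding M_def by (intro add_le_mono1 mult_le_mono1)
      finally show ?thesis .
    qed
    moreover have "3 + 2 * Suc j = 2 * t + 1" "t - 1 = j + 1" "t - 2 = j" "t \<ge> 2" using j by simp_all
    moreover have "(M * ?q + 2) * ?q ^ j > 0" using q5 by simp
    ultimately show ?thesis using that[of "(M * ?q + 2) * ?q ^ j" g'] g' by (simp only: if_True)
  qed
  have "u * N \<le> n" using N(4) n by (meson le_trans mult_le_mono2)
  from direct_sum_covering_code[OF N(1,3) this N(2)] show ?thesis .
qed


text \<open>As \<open>r / R = t + 1 / 2\<close>, the exponents of \<open>q\<close> are
  \<open>t - 1 / 2\<close>, \<open>t - 2\<close>, \<open>t - 3\<close> and \<open>t - 4\<close>. The
  surplus factor \<open>sqrt q = s\<close> of the first turns \<open>Y\<close> into the integer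
  \<open>A\<close>, and \<open>f_corr\<close> is nonzero exactly for \<open>t = 4\<close> and
  \<open>t = 6\<close>.\<close>

lemma length_formula:
  fixes q s t u r R A :: nat and Y :: real
  assumes q: "q = s ^ 2" and s: "s > 1" and u: "u \<ge> 1" and R: "R = 2 * u" and t: "t \<ge> 1" and r: "r = t * R + u"
    and Y: "Y * real s = real A"
  shows "real R * Y * real q powr ((real r - real R) / real R)
      + real R * of_int \<lfloor>real q powr ((real r - 2 * real R) / real R - 1 / 2)\<rfloor>
      + real R / 2 * f_corr q (int r) (int R)
    = real (u * (2 * A * q ^ (t - 1) + (if t \<ge> 2 then 2 * q ^ (t - 2) else 0) +
        (if t = 4 \<or> t = 6 then q ^ (t - 3) + q ^ (t - 4) else 0)))"
proof -
  have R0: "real R > 0" using R u by simp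
  have rr: "real r = (real t + 1 / 2) * real R" unfolding r R by (simp add: algebra_simps)
  have quot: "(real r - c * real R) / real R = real t + 1 / 2 - c" for c
    using R0 unfolding rr by (simp add: field_simps)
  have q1: "real q > 1" using s unfolding q by (simp add: one_less_power)
  have sq: "real q powr (1 / 2) = real s" unfolding q using s by (simp add: powr_half_sqrt)
  have pw: "real q powr real n = real q ^ n" for n using q1 by (simp add: powr_realpow)
  have 1: "real q powr ((real r - real R) / real R) = real q ^ (t - 1) * real s"
  proof -
    have "(real r - real R) / real R = real (t - 1) + 1 / 2" using quot[of 1] t by (simp add: of_nat_diff)
    then show ?thesis by (simp add: powr_add sq pw)
  qed
  have 2: "of_int \<lfloor>real q powr ((real r - 2 * real R) / real R - 1 / 2)\<rfloor> = (if t \<ge> 2 then real (q ^ (t - 2)) else 0)"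
  proof (cases "t \<ge> 2")
    case True
    then have "(real r - 2 * real R) / real R - 1 / 2 = real (t - 2)" using quot[of 2] by (simp add: of_nat_diff)
    then have "real q powr ((real r - 2 * real R) / real R - 1 / 2) = real (q ^ (t - 2))" by (simp only: pw of_nat_power)
    then show ?thesis using True by simp
  next
    \<comment> \<open>For \<open>t = 1\<close> the floor is that of \<open>1 / q\<close>, hence
      0.\<close>
    case False
    then have "t = 1" using t by simp
    then have "(real r - 2 * real R) / real R - 1 / 2 = - 1" using quot[of 2] by simp
    then have "real q powr ((real r - 2 * real R) / real R - 1 / 2) = 1 / real q" using q1 by (simp add: powr_minus_divide)
    moreover have "\<lfloor>1 / real q\<rfloor> = 0" using q1 by (simp add: floor_eq_iff)
    ultimately show ?thesis using False by simp
  qed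
  have 3: "f_corr q (int r) (int R) = (if t = 4 \<or> t = 6 then real (q ^ (t - 3)) + real (q ^ (t - 4)) else 0)"
  proof -
    have "real r = 9 * real R / 2 \<longleftrightarrow> t = 4" "real r = 13 * real R / 2 \<longleftrightarrow> t = 6"
      unfolding rr using R0 by (auto simp: field_simps)
    then have iff: "real_of_int (int r) \<in> {9 * real_of_int (int R) / 2, 13 * real_of_int (int R) / 2} \<longleftrightarrow> t = 4 \<or> t = 6"
      by simp
    show ?thesis
    proof (cases "t = 4 \<or> t = 6")
      case True
      then have "(real r - 3 * real R) / real R - 1 / 2 = real (t - 3)" "(real r - 4 * real R) / real R - 1 / 2 = real (t - 4)"
        using quot[of 3] quot[of 4] by auto
      then show ?thesis unfolding f_corr_def iff using True by (simp only: of_int_of_nat_eq pw of_nat_power if_True)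
    next
      case False
      then show ?thesis unfolding f_corr_def iff by simp
    qed
  qed
  have "real R * Y * (real q ^ (t - 1) * real s) = real R * real A * real q ^ (t - 1)"
    unfolding Y[symmetric] by simp
  then show ?thesis unfolding 1 2 3 using R by (auto simp: algebra_simps)
qed

theorem theorem6p2:
  fixes p q h r R t :: nat
  assumes "Factorial_Ring.prime p" and "h \<ge> 2" and "q = p ^ (2 * h)" and "CARD('a::{field,finite}) = q"
    and "R \<ge> 2" and "even R" and "t \<ge> 1" and "r = t * R + R div 2"
  shows
    "(p \<ge> 3 \<longrightarrow>
       (\<exists>n (C :: 'a vec set).
          real n = real R * (1 + (sqrt (real q) - 1) / (sqrt (real q) * (real (phi (p ^ h)) - 1)))
                     * real q powr ((real r - real R) / real R)
                 + real R * of_int \<lfloor>real q powr ((real r - 2 * real R) / real R - 1 / 2)\<rfloor>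
                 + real R / 2 * f_corr q (int r) (int R)
          \<and> covering_code n r R C)) \<and>
     (p \<ge> 7 \<longrightarrow>
       (\<exists>n (C :: 'a vec set).
          real n = real R * (1 + 1 / real p + 1 / sqrt (real q))
                     * real q powr ((real r - real R) / real R)
                 + real R * of_int \<lfloor>real q powr ((real r - 2 * real R) / real R - 1 / 2)\<rfloor>
                 + real R / 2 * f_corr q (int r) (int R)
          \<and> covering_code n r R C))"
proof -
  let ?s = "p ^ h"
  define u where "u = R div 2"
  have R: "R = 2 * u" and u: "u \<ge> 1" using assms(5,6) by (auto simp: u_def)
  have r: "r = t * R + u" using assms(8) by (simp add: u_def)
  have r': "r = u * (2 * t + 1)" unfolding r R by (simp add: algebra_simps)
  have qs: "q = ?s ^ 2" unfolding assms(3) by (simp add: power_mult mult.commute)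
  have p1: "p > 1" using prime_gt_1_nat[OF assms(1)] .
  have ps: "p < ?s" using p1 assms(2) power_strict_increasing[of 1 h p] by simp
  have s1: "?s > 1" using ps p1 by linarith
  have sq: "sqrt (real q) = real ?s" unfolding qs by simp
  have card: "CARD('a) = p ^ (2 * h)" using assms(3,4) by simp
  \<comment> \<open>Both lengths have this shape with \<open>A\<close> at least the size bound
    \<open>?s + m + 1\<close> of a blocking set; any excess and the \<open>f_corr\<close> term are
    filled by zero columns.\<close>
  have main: "\<exists>n (C :: 'a vec set). real n = real R * Y * real q powr ((real r - real R) / real R)
      + real R * of_int \<lfloor>real q powr ((real r - 2 * real R) / real R - 1 / 2)\<rfloor>
      + real R / 2 * f_corr q (int r) (int R) \<and> covering_code n r R C"
    if \<kappa>: "3 \<le> \<kappa>" "\<kappa> < ?s" "?s = \<kappa> * m" "\<kappa> - 1 dvd ?s - 1"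
      and A: "?s + m + 1 \<le> A" and Y: "Y * real ?s = real A" for \<kappa> m A Y
  proof -
    let ?n = "u * (2 * A * q ^ (t - 1) + (if t \<ge> 2 then 2 * q ^ (t - 2) else 0) +
        (if t = 4 \<or> t = 6 then q ^ (t - 3) + q ^ (t - 4) else 0))"
    have "u * (2 * (?s + m + 1) * CARD('a) ^ (t - 1) + (if t \<ge> 2 then 2 * CARD('a) ^ (t - 2) else 0)) \<le> ?n"
      unfolding assms(4) using A by (intro mult_le_mono2 trans_le_add1 add_le_mono1 mult_le_mono1)
    from covering_code_exists[OF assms(1) card \<kappa> assms(7) this]
    obtain C :: "'a vec set" where "covering_code ?n r R C" unfolding r'[symmetric] R[symmetric] by blast
    moreover have "real ?n = real R * Y * real q powr ((real r - real R) / real R)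
      + real R * of_int \<lfloor>real q powr ((real r - 2 * real R) / real R - 1 / 2)\<rfloor>
      + real R / 2 * f_corr q (int r) (int R)"
      using length_formula[OF qs s1 u R assms(7) r Y] by (rule sym)
    ultimately show ?thesis by blast
  qed
  show ?thesis
  proof (intro conjI impI)
    assume p3: "p \<ge> 3"
    define \<kappa> where "\<kappa> = phi ?s"
    have \<kappa>: "1 < \<kappa>" "\<kappa> < ?s" "\<kappa> dvd ?s" "\<kappa> - 1 dvd ?s - 1"
      using phi_subfield[OF assms(1,2) card] by (simp_all add: \<kappa>_def)
    \<comment> \<open>A power of \<open>p\<close> greater than 1 is at least
      \<open>p\<close>.\<close>
    obtain e where e: "\<kappa> = p ^ e" using \<kappa>(3) divides_primepow_nat[OF assms(1)] by blast
    then have "e \<noteq> 0" using \<kappa>(1) by (cases e) auto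
    then have "p \<le> \<kappa>" using e p1 self_le_power[of p e] by simp
    then have \<kappa>3: "3 \<le> \<kappa>" using p3 by linarith
    obtain m where m: "?s = \<kappa> * m" using \<kappa>(3) by auto
    \<comment> \<open>Here \<open>A = ?s + c\<close>: the fraction in the length times
      \<open>?s\<close> is the integer \<open>c\<close>.\<close>
    define c where "c = (?s - 1) div (\<kappa> - 1)"
    have "?s - 1 = c * (\<kappa> - 1)" using \<kappa>(4) by (simp add: c_def)
    then have "real (?s - 1) = real (c * (\<kappa> - 1))" by (rule arg_cong)
    then have c: "real ?s - 1 = real c * (real \<kappa> - 1)" using \<kappa>(1) s1 by (simp add: of_nat_diff)
    have "real \<kappa> - 1 \<noteq> 0" "real ?s \<noteq> 0" using \<kappa>(1) s1 by linarith+
    then have "(1 + (real ?s - 1) / (real ?s * (real \<kappa> - 1))) * real ?s = real (?s + c)"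
      unfolding c by (simp add: distrib_right)
    from main[OF \<kappa>3 \<kappa>(2) m \<kappa>(4) subfield_order_sqrt(2)[OF \<kappa>(1,2) m \<kappa>(4), folded c_def] this]
    show "\<exists>n (C :: 'a vec set).
          real n = real R * (1 + (sqrt (real q) - 1) / (sqrt (real q) * (real (phi (p ^ h)) - 1)))
                     * real q powr ((real r - real R) / real R)
                 + real R * of_int \<lfloor>real q powr ((real r - 2 * real R) / real R - 1 / 2)\<rfloor>
                 + real R / 2 * f_corr q (int r) (int R)
          \<and> covering_code n r R C"
      unfolding sq \<kappa>_def .
  next
    assume p7: "p \<ge> 7"
    \<comment> \<open>With the subfield of order \<open>p\<close> the coefficient matches the size
      bound of a blocking set exactly: \<open>A = ?s + m + 1\<close>.\<close>
    define m where "m = p ^ (h - 1)"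
    have m: "?s = p * m" unfolding m_def using assms(2) by (cases h) auto
    define S where "S = real ?s"
    have "S = real p * real m" unfolding S_def m by (rule of_nat_mult)
    then have "S / real p = real m" using p1 by simp
    moreover have "S \<noteq> 0" unfolding S_def using s1 by linarith
    moreover have "(1 + 1 / real p + 1 / S) * S = S + S / real p + S / S" by (simp add: distrib_right)
    ultimately have "(1 + 1 / real p + 1 / S) * S = S + real m + 1" by simp
    then have Y: "(1 + 1 / real p + 1 / real ?s) * real ?s = real (?s + m + 1)" unfolding S_def by simp
    have "3 \<le> p" using p7 by linarith
    from main[OF this ps m minus_1_dvd_power_minus_1 order.refl Y]
    show "\<exists>n (C :: 'a vec set).
          real n = real R * (1 + 1 / real p + 1 / sqrt (real q))
                     * real q powr ((real r - real R) / real R)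
                 + real R * of_int \<lfloor>real q powr ((real r - 2 * real R) / real R - 1 / 2)\<rfloor>
                 + real R / 2 * f_corr q (int r) (int R)
          \<and> covering_code n r R C"
      unfolding sq .
  qed
qed

end
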